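(* Let $\nu\ge0$ and let $(\kappa_k)_{k\ge1}$ be a sequence of positive reals with $\kappa_k\asymp k^{-\nu}$. Consider the inverse regression model in which, given $f$, one observes independently $X_k\mid f_k\sim\mathcal N(\kappa_kf_k,1/n)$, $k\ge1$, and write $X^{(n)}=(X_1,X_2,\dots)$. Let $h$ be a probability density on $\mathbb R$ such that: (i) $h$ is symmetric, positive, bounded, and decreasing on $[0,\infty)$; (ii) for some $c_1>0$, $\kappa\ge0$, $\log(1/h(x))\le c_1(1+\log^{1+\kappa}(1+x))$ for all $x\ge0$; (iii) $\int_{-\infty}^\infty x^2h(x)\,dx<\infty$. Let $\Pi$ be the prior on $f=(f_k)_{k\ge1}$ under which $f_k=\sigma_k\zeta_k$ with $(\zeta_k)$ i.i.d. of density $h$ and $\sigma_k=e^{-(\log k)^2}$. Suppose $f_0\in\mathcal S^\beta(L)$ for some $\beta,L>0$. Then there exists $d>0$ such that, with $\mathcal L_n=(\log n)^d$, as $n\to\infty$, $$E_{f_0}\Pi\left[\{f:\ \|f-f_0\|_2>\mathcal L_n\,n^{-\beta/(2\beta+2\nu+1)}\}\,\middle|\,X^{(n)}\right]\to0.$$ Further, the same result holds, with a possibly different $d$, when instead $\sigma_k=k^{-1/2-\alpha}$ for some $\alpha>0$, provided $\alpha\ge\beta$.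
   Context: Functions $f\in L^2[0,1]$ are identified with their coefficient sequences $(f_k)_{k\ge1}$ on a fixed orthonormal basis of $L^2[0,1]$, so $\|f\|_2^2=\sum_kf_k^2$. The relation $\kappa_k\asymp k^{-\nu}$ means that there are constants $0<c\le C$ with $ck^{-\nu}\le\kappa_k\le Ck^{-\nu}$ for all $k\ge1$ (the sequence $(\kappa_k)$ is unrelated to the constant $\kappa$ in (ii)). The Sobolev-type ball is $\mathcal S^\beta(L)=\{f=(f_k):\ \sum_{k\ge1}k^{2\beta}f_k^2\le L^2\}$. $\Pi[\cdot\mid X^{(n)}]$ is the posterior distribution of $f$ given $X^{(n)}$: under it the $f_k$ are independent, $f_k$ having density proportional to $\theta\mapsto e^{-n(X_k-\kappa_k\theta)^2/2}h(\theta/\sigma_k)$. $E_{f_0}$ is the expectation when $X_k\sim\mathcal N(\kappa_kf_{0,k},1/n)$ independently. *)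

theory Defs
  imports "HOL-Probability.Probability"
begin

text \<open>
  Sequences \<open>(a\<^sub>k)\<^sub>k\<^sub>\<ge>\<^sub>1\<close> are functions on \<^typ>\<open>nat\<close> of which only the values on \<open>{1..}\<close> matter.
  Product measures are therefore indexed by \<open>{1..}\<close>, and their points are extensional functions:
  events have to be intersected with the space of the measure in order to be measurable.
\<close>

definition asymp_power :: "(nat \<Rightarrow> real) \<Rightarrow> real \<Rightarrow> bool" where
  "asymp_power \<kappa> \<nu> \<longleftrightarrow>
     (\<exists>c C. 0 < c \<and> c \<le> C \<and>
        (\<forall>k\<ge>1. c * real k powr (- \<nu>) \<le> \<kappa> k \<and> \<kappa> k \<le> C * real k powr (- \<nu>)))"

definition sobolev_ball :: "real \<Rightarrow> real \<Rightarrow> (nat \<Rightarrow> real) set" where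
  "sobolev_ball \<beta> L =
     {f. (\<lambda>k. real k powr (2 * \<beta>) * (f k)\<^sup>2) summable_on {1..} \<and>
         (\<Sum>\<^sub>\<infinity>k\<in>{1..}. real k powr (2 * \<beta>) * (f k)\<^sup>2) \<le> L\<^sup>2}"

text \<open>
  The posterior lives on all sequences, so the norm is extended by \<open>\<infinity>\<close> outside the
  square-summable ones (an infinite sum of reals would be \<open>0\<close> there).
\<close>

definition l2norm :: "(nat \<Rightarrow> real) \<Rightarrow> ereal" where
  "l2norm f =
     (if (\<lambda>k. (f k)\<^sup>2) summable_on {1..} then ereal (sqrt (\<Sum>\<^sub>\<infinity>k\<in>{1..}. (f k)\<^sup>2)) else \<infinity>)"

text \<open>The law of the observation: \<open>normal_density\<close> takes the standard deviation as second argument.\<close>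

definition obs_law :: "(nat \<Rightarrow> real) \<Rightarrow> (nat \<Rightarrow> real) \<Rightarrow> nat \<Rightarrow> (nat \<Rightarrow> real) measure" where
  "obs_law \<kappa> f n =
     PiM {1..} (\<lambda>k. density lborel (\<lambda>x. ennreal (normal_density (\<kappa> k * f k) (1 / sqrt (real n)) x)))"

definition coord_weight :: "(real \<Rightarrow> real) \<Rightarrow> real \<Rightarrow> real \<Rightarrow> nat \<Rightarrow> real \<Rightarrow> real \<Rightarrow> real" where
  "coord_weight h s q n x \<theta> = exp (- (real n * (x - q * \<theta>)\<^sup>2 / 2)) * h (\<theta> / s)"

definition coord_posterior :: "(real \<Rightarrow> real) \<Rightarrow> real \<Rightarrow> real \<Rightarrow> nat \<Rightarrow> real \<Rightarrow> real measure" where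
  "coord_posterior h s q n x =
     density lborel
       (\<lambda>\<theta>. ennreal (coord_weight h s q n x \<theta> / (LINT t|lborel. coord_weight h s q n x t)))"

definition posterior ::
  "(real \<Rightarrow> real) \<Rightarrow> (nat \<Rightarrow> real) \<Rightarrow> (nat \<Rightarrow> real) \<Rightarrow> nat \<Rightarrow> (nat \<Rightarrow> real) \<Rightarrow> (nat \<Rightarrow> real) measure"
where
  "posterior h \<sigma> \<kappa> n X = PiM {1..} (\<lambda>k. coord_posterior h (\<sigma> k) (\<kappa> k) n (X k))"

definition contracts_at ::
  "(real \<Rightarrow> real) \<Rightarrow> (nat \<Rightarrow> real) \<Rightarrow> (nat \<Rightarrow> real) \<Rightarrow> (nat \<Rightarrow> real) \<Rightarrow> (nat \<Rightarrow> real) \<Rightarrow> bool"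
where
  "contracts_at h \<sigma> \<kappa> f0 \<epsilon> \<longleftrightarrow>
     ((\<lambda>n. \<integral>\<^sup>+ X. emeasure (posterior h \<sigma> \<kappa> n X)
                 {f \<in> space (posterior h \<sigma> \<kappa> n X). l2norm (\<lambda>k. f k - f0 k) > ereal (\<epsilon> n)}
            \<partial>obs_law \<kappa> f0 n)
       \<longlongrightarrow> 0) sequentially"

text \<open>
  The next lemma ties the posterior to the prior: its coordinates are the Bayes updates of the
  law of \<open>\<sigma>\<^sub>k \<zeta>\<^sub>k\<close>, where \<open>\<zeta>\<^sub>k\<close> has density \<open>h\<close>, by the Gaussian likelihood.
\<close>

definition coord_prior :: "(real \<Rightarrow> real) \<Rightarrow> real \<Rightarrow> real measure" where
  "coord_prior h s = distr (density lborel (\<lambda>z. ennreal (h z))) borel (\<lambda>z. s * z)"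

lemma coord_prior_eq_density:
  assumes h: "h \<in> borel_measurable borel" and nn: "\<And>z. 0 \<le> h z" and s: "0 < s"
  shows "coord_prior h s = density lborel (\<lambda>\<theta>. ennreal (h (\<theta> / s) / s))"
proof (rule measure_eqI)
  fix A assume "A \<in> sets (coord_prior h s)"
  then have A [measurable]: "A \<in> sets borel" by (simp add: coord_prior_def)
  note h [measurable]
  have "emeasure (density lborel (\<lambda>\<theta>. ennreal (h (\<theta> / s) / s))) A =
      (\<integral>\<^sup>+\<theta>. ennreal (h (\<theta> / s) / s) * indicator A \<theta> \<partial>lborel)"
    by (subst emeasure_density) auto
  also have "\<dots> = ennreal s * (\<integral>\<^sup>+z. ennreal (h z / s) * indicator A (s * z) \<partial>lborel)"
    using s by (subst nn_integral_real_affine[where c = s and t = 0]) auto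
  also have "\<dots> = (\<integral>\<^sup>+z. ennreal (h z) * indicator A (s * z) \<partial>lborel)"
    using s nn
    by (subst nn_integral_cmult[symmetric])
       (auto simp flip: ennreal_mult simp: mult.assoc[symmetric] intro!: nn_integral_cong)
  also have "\<dots> = emeasure (coord_prior h s) A"
  proof -
    have pre: "(\<lambda>z. s * z) -` A \<in> sets borel"
      using measurable_sets[of "\<lambda>z. s * z" borel borel A] by simp
    have "emeasure (coord_prior h s) A = emeasure (density lborel (\<lambda>z. ennreal (h z))) ((\<lambda>z. s * z) -` A)"
      unfolding coord_prior_def by (subst emeasure_distr) auto
    also have "\<dots> = (\<integral>\<^sup>+z. ennreal (h z) * indicator A (s * z) \<partial>lborel)"
      using pre by (subst emeasure_density) (auto simp: indicator_def intro!: nn_integral_cong)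
    finally show ?thesis by simp
  qed
  finally show "emeasure (coord_prior h s) A =
      emeasure (density lborel (\<lambda>\<theta>. ennreal (h (\<theta> / s) / s))) A" ..
qed (simp add: coord_prior_def)

lemma coord_posterior_eq_bayes:
  assumes h: "h \<in> borel_measurable borel" and nn: "\<And>z. 0 \<le> h z" and s: "0 < s" and n: "0 < n"
  shows "coord_posterior h s q n x =
    density (coord_prior h s)
      (\<lambda>\<theta>. ennreal (normal_density (q * \<theta>) (1 / sqrt n) x /
                   (LINT t|coord_prior h s. normal_density (q * t) (1 / sqrt n) x)))"
proof -
  note h [measurable]
  define lik where "lik \<theta> = normal_density (q * \<theta>) (1 / sqrt n) x" for \<theta>
  define K where "K = sqrt n / (sqrt (2 * pi) * s)"
  have K: "K > 0" using n s by (simp add: K_def)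
  have lik_nn: "0 \<le> lik \<theta>" for \<theta> by (simp add: lik_def)
  have [measurable]: "lik \<in> borel_measurable borel"
    unfolding lik_def normal_density_def by measurable
  have w: "lik \<theta> * (h (\<theta> / s) / s) = K * coord_weight h s q n x \<theta>" for \<theta>
    using n s
    by (simp add: lik_def K_def coord_weight_def normal_density_def real_sqrt_mult
        real_sqrt_divide power_divide field_simps)
  have ev: "(LINT t|coord_prior h s. lik t) = K * (LINT t|lborel. coord_weight h s q n x t)"
    unfolding coord_prior_eq_density[OF h nn s]
    using nn s
    by (subst integral_real_density) (auto simp: w mult.commute[of _ "lik _"] simp flip: times_divide_eq_right)
  have "density (coord_prior h s) (\<lambda>\<theta>. ennreal (lik \<theta> / (LINT t|coord_prior h s. lik t))) =
      density lborel (\<lambda>\<theta>. ennreal (h (\<theta> / s) / s) *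
        ennreal (lik \<theta> / (LINT t|coord_prior h s. lik t)))"
    unfolding coord_prior_eq_density[OF h nn s] by (rule density_density_eq) auto
  also have "\<dots> = coord_posterior h s q n x"
    unfolding coord_posterior_def
  proof (rule arg_cong[where f = "density lborel"], rule ext)
    fix \<theta>
    have "h (\<theta> / s) / s * (lik \<theta> / (LINT t|coord_prior h s. lik t)) =
        coord_weight h s q n x \<theta> / (LINT t|lborel. coord_weight h s q n x t)"
      using w[of \<theta>] K unfolding ev by (simp add: mult.commute)
    then show "ennreal (h (\<theta> / s) / s) * ennreal (lik \<theta> / (LINT t|coord_prior h s. lik t)) =
        ennreal (coord_weight h s q n x \<theta> / (LINT t|lborel. coord_weight h s q n x t))"
      using nn s by (metis ennreal_mult' divide_nonneg_pos)
  qed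
  finally show ?thesis by (simp add: lik_def)
qed

end

theory Submission
  imports Defs
begin

text \<open>
  By Markov's inequality it suffices to bound the posterior risks of the coordinates. Write \<open>\<tau>\<close>
  for the noise level \<open>1 / (sqrt n * \<kappa> k)\<close> of coordinate \<open>k\<close>, and \<open>K\<close> for
  \<open>n powr (1 / (2 * \<beta> + 2 * \<nu> + 1))\<close>. Because \<open>ln (1 / h)\<close> grows polylogarithmically, comparing the
  Gaussian weight with the mass it gives to a neighbourhood of the observation shows that the risk
  is always of order \<open>\<tau>\<^sup>2\<close> up to powers of \<open>1 + ln k\<close>. This is enough for \<open>k \<le> K\<close>, and also for
  \<open>k > K\<close> when the signal \<open>f0 k\<close> is detectable, that is, exceeds \<open>\<tau>\<close> up to a logarithm. For the
  undetectable coordinates \<open>k > K\<close> the prior scale is below \<open>\<tau>\<close>; there the observation behaves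
  like pure noise, for which the expected posterior second moment is at most a constant times the
  prior second moment, and the shrinkage costs only \<open>(f0 k)\<^sup>2\<close>. All logarithmic factors are absorbed
  into \<open>(ln n) powr d\<close>.
\<close>

section \<open>Gaussian weights\<close>

text \<open>The prior scale may lie far below the signal, as \<open>exp (- (ln k)\<^sup>2)\<close>
  does. This costs only logarithms, because the posterior second moment pays the logarithm of the
  ratio between the bound of \<open>h\<close> and its value near the rescaled observation, and
  \<open>ln (1 / \<sigma> k)\<close> is at most of order \<open>(1 + ln k)\<^sup>2\<close>. That
  bound cannot serve at all frequencies: \<open>\<tau>\<^sup>2\<close> is of order
  \<open>k powr (2 * \<nu>) / n\<close>, whose sum over \<open>k\<close> diverges. Beyond the cutoff
  the smallness has to come from the prior, but the likelihood ratio of signal against pure noise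
  has the cross term \<open>n * x * \<kappa> k * f0 k\<close> in its exponent and is unbounded in
  \<open>x\<close>. Truncating at \<open>\<bar>sqrt n * x\<bar> \<le> T\<close> with
  \<open>T = 1 + 2 * ln k\<close> tames it as soon as
  \<open>\<bar>f0 k\<bar> * T \<le> \<tau>\<close>, whence the logarithm in the notion of
  detectability. In the opposite case \<open>\<tau>\<^sup>2\<close> is below
  \<open>(f0 k)\<^sup>2\<close> up to logarithms, and the Sobolev series makes the risks
  summable.\<close>

lemma integral_gaussian_kernel:
  fixes y \<tau> :: real
  assumes "0 < \<tau>"
  shows "integrable lborel (\<lambda>\<theta>. exp (- ((\<theta> - y) / \<tau>)\<^sup>2 / 4))"
    and "(LINT \<theta>|lborel. exp (- ((\<theta> - y) / \<tau>)\<^sup>2 / 4)) = 2 * \<tau> * sqrt pi"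
proof -
  have eq: "(\<lambda>\<theta>. exp (- ((\<theta> - y) / \<tau>)\<^sup>2 / 4)) =
      (\<lambda>\<theta>. 2 * \<tau> * sqrt pi * normal_density y (sqrt 2 * \<tau>) \<theta>)"
  proof
    fix \<theta>
    have "2 * pi * (sqrt 2 * \<tau>)\<^sup>2 = (2 * \<tau> * sqrt pi)\<^sup>2"
      by (simp add: power_mult_distrib)
    then have "sqrt (2 * pi * (sqrt 2 * \<tau>)\<^sup>2) = 2 * \<tau> * sqrt pi"
      using assms by (metis real_sqrt_unique less_imp_le mult_nonneg_nonneg real_sqrt_ge_0_iff pi_ge_zero zero_le_numeral)
    then show "exp (- ((\<theta> - y) / \<tau>)\<^sup>2 / 4) = 2 * \<tau> * sqrt pi * normal_density y (sqrt 2 * \<tau>) \<theta>"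
      using assms by (simp add: normal_density_def power_mult_distrib power_divide)
  qed
  show "integrable lborel (\<lambda>\<theta>. exp (- ((\<theta> - y) / \<tau>)\<^sup>2 / 4))"
    unfolding eq using assms by (intro integrable_mult_right integrable_normal_density) auto
  show "(LINT \<theta>|lborel. exp (- ((\<theta> - y) / \<tau>)\<^sup>2 / 4)) = 2 * \<tau> * sqrt pi"
    unfolding eq using assms by (simp add: integral_normal_density)
qed

text \<open>Jensen's inequality for the exponential moment: half of the Gaussian exponent is spent
  on \<open>exp u\<close>, the other half still integrates, and the mean of \<open>u\<close> is at
  most the logarithm of the mean of \<open>exp u\<close>. So a weight \<open>g\<close> that is tiny
  near \<open>y\<close> enters only through \<open>ln (B / b)\<close>.\<close>

lemma gaussian_weight_concentration:
  fixes g :: "real \<Rightarrow> real" and y \<tau> B b :: real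
  defines "w \<equiv> \<lambda>\<theta>. exp (- ((\<theta> - y) / \<tau>)\<^sup>2 / 2) * g \<theta>"
  assumes [measurable]: "g \<in> borel_measurable borel"
    and g: "\<And>\<theta>. 0 \<le> g \<theta>" "\<And>\<theta>. g \<theta> \<le> B"
    and \<tau>: "0 < \<tau>" and b: "0 < b" "\<And>\<theta>. \<bar>\<theta> - y\<bar> \<le> \<tau> \<Longrightarrow> b \<le> g \<theta>"
  shows "integrable lborel w"
    and "integrable lborel (\<lambda>\<theta>. (\<theta> - y)\<^sup>2 * w \<theta>)"
    and "\<tau> * b \<le> (LINT \<theta>|lborel. w \<theta>)"
    and "(LINT \<theta>|lborel. (\<theta> - y)\<^sup>2 * w \<theta>) \<le> 4 * \<tau>\<^sup>2 * ln (4 * B / b) * (LINT \<theta>|lborel. w \<theta>)"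
proof -
  \<comment> \<open>Half of the exponent of \<open>w\<close>, so that \<open>exp u * w\<close> is
    still dominated by the integrable kernel \<open>B * G\<close>.\<close>
  define u where "u \<theta> = ((\<theta> - y) / \<tau>)\<^sup>2 / 4" for \<theta>
  define G where "G \<theta> = exp (- u \<theta>)" for \<theta>
  have [measurable]: "u \<in> borel_measurable borel" "G \<in> borel_measurable borel" "w \<in> borel_measurable borel"
    unfolding u_def G_def w_def by measurable
  have w_eq: "w \<theta> = exp (- 2 * u \<theta>) * g \<theta>" for \<theta>
    by (simp add: w_def u_def)
  have u0: "0 \<le> u \<theta>" for \<theta> by (simp add: u_def)
  have w0: "0 \<le> w \<theta>" for \<theta> using g by (simp add: w_eq)
  have "b \<le> g y" using b(2)[of y] \<tau> by simp
  then have B: "0 < B" using b(1) g(2)[of y] by linarith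
  have G: "integrable lborel G" "(LINT \<theta>|lborel. G \<theta>) = 2 * \<tau> * sqrt pi"
    using integral_gaussian_kernel[OF \<tau>, of y] by (simp_all add: G_def[abs_def] u_def)
  have ewG: "exp (u \<theta>) * w \<theta> \<le> B * G \<theta>" for \<theta>
  proof -
    have "exp (u \<theta>) * w \<theta> = exp (u \<theta> + - 2 * u \<theta>) * g \<theta>"
      unfolding w_eq exp_add by (rule mult.assoc[symmetric])
    also have "\<dots> = G \<theta> * g \<theta>" by (simp add: G_def)
    also have "\<dots> \<le> G \<theta> * B" using g by (intro mult_left_mono) (auto simp: G_def)
    finally show ?thesis by (simp add: mult.commute)
  qed
  have wG: "w \<theta> \<le> B * G \<theta>" for \<theta>
    using ewG[of \<theta>] mult_right_mono[OF one_le_exp_iff[THEN iffD2, OF u0[of \<theta>]] w0[of \<theta>]] by simp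
  have uwG: "u \<theta> * w \<theta> \<le> B * G \<theta>" for \<theta>
    using ewG[of \<theta>] mult_right_mono[OF _ w0[of \<theta>], of "u \<theta>" "exp (u \<theta>)"] exp_ge_add_one_self[of "u \<theta>"] by linarith
  show iw: "integrable lborel w"
    by (rule Bochner_Integration.integrable_bound[OF integrable_mult_right[OF G(1), of B]])
       (use wG w0 B in \<open>auto simp: G_def\<close>)
  have iuw: "integrable lborel (\<lambda>\<theta>. u \<theta> * w \<theta>)"
    by (rule Bochner_Integration.integrable_bound[OF integrable_mult_right[OF G(1), of B]])
       (use uwG w0 u0 B in \<open>auto simp: G_def abs_mult\<close>)
  have sq: "(\<lambda>\<theta>. (\<theta> - y)\<^sup>2 * w \<theta>) = (\<lambda>\<theta>. 4 * \<tau>\<^sup>2 * (u \<theta> * w \<theta>))"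
    using \<tau> by (auto simp: u_def power_divide)
  show "integrable lborel (\<lambda>\<theta>. (\<theta> - y)\<^sup>2 * w \<theta>)"
    unfolding sq by (intro integrable_mult_right iuw)
  have exp_half: "exp (1/2) \<le> (2::real)"
    by (rule exp_bound_half[of "1/2::real", simplified])
  show Wb: "\<tau> * b \<le> (LINT \<theta>|lborel. w \<theta>)"
  proof -
    \<comment> \<open>The interval has length \<open>2 * \<tau>\<close>; on it the Gaussian factor
      is at least \<open>exp (- 1 / 2)\<close>, hence at least \<open>1 / 2\<close>.\<close>
    have "\<tau> * b = (LINT \<theta>|lborel. (b / 2) * indicator {y - \<tau>..y + \<tau>} \<theta>)"
      using \<tau> by simp
    also have "\<dots> \<le> (LINT \<theta>|lborel. w \<theta>)"
    proof (rule integral_mono[OF _ iw])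
      show "integrable lborel (\<lambda>\<theta>. (b / 2) * indicator {y - \<tau>..y + \<tau>} \<theta> :: real)"
        by (intro integrable_mult_right integrable_real_indicator) (auto simp: emeasure_lborel_Icc_eq)
      fix \<theta>
      show "b / 2 * indicator {y - \<tau>..y + \<tau>} \<theta> \<le> w \<theta>"
      proof (cases "\<theta> \<in> {y - \<tau>..y + \<tau>}")
        case True
        then have a: "\<bar>\<theta> - y\<bar> \<le> \<tau>" by auto
        then have "((\<theta> - y) / \<tau>)\<^sup>2 \<le> 1"
          using \<tau> by (simp add: abs_square_le_1)
        then have "exp (- (1 / 2)) \<le> exp (- 2 * u \<theta>)" by (simp add: u_def)
        moreover have "1 / 2 \<le> exp (- (1 / 2) :: real)"
          using exp_half by (simp add: exp_minus field_simps)
        ultimately have "1 / 2 \<le> exp (- 2 * u \<theta>)" by linarith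
        from mult_mono[OF this b(2)[OF a]] have "1 / 2 * b \<le> exp (- 2 * u \<theta>) * g \<theta>"
          using b by simp
        then show ?thesis using True by (simp add: w_eq)
      qed (use w0 in auto)
    qed
    finally show ?thesis .
  qed
  \<comment> \<open>Integrating \<open>u \<le> ln \<Lambda> - 1 + exp u / \<Lambda>\<close> against \<open>w\<close>; this \<open>\<Lambda>\<close> is an upper bound of the ratio of \<open>\<integral> exp u * w\<close> to \<open>\<integral> w\<close>.\<close>
  define \<Lambda> where "\<Lambda> = 4 * B / b"
  have \<Lambda>: "0 < \<Lambda>" using B b by (simp add: \<Lambda>_def)
  have "(LINT \<theta>|lborel. u \<theta> * w \<theta>) \<le> (LINT \<theta>|lborel. (ln \<Lambda> - 1) * w \<theta> + B / \<Lambda> * G \<theta>)"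
  proof (rule integral_mono[OF iuw])
    show "integrable lborel (\<lambda>\<theta>. (ln \<Lambda> - 1) * w \<theta> + B / \<Lambda> * G \<theta>)"
      using iw G by (intro Bochner_Integration.integrable_add integrable_mult_right)
    fix \<theta>
    have "1 + (u \<theta> - ln \<Lambda>) \<le> exp (u \<theta>) / \<Lambda>"
      using exp_ge_add_one_self[of "u \<theta> - ln \<Lambda>"] \<Lambda> by (simp add: exp_diff)
    then have "u \<theta> * w \<theta> \<le> (ln \<Lambda> - 1 + exp (u \<theta>) / \<Lambda>) * w \<theta>"
      using w0 by (intro mult_right_mono) auto
    also have "\<dots> = (ln \<Lambda> - 1) * w \<theta> + (exp (u \<theta>) * w \<theta>) / \<Lambda>"
      by (simp add: field_simps)
    also have "\<dots> \<le> (ln \<Lambda> - 1) * w \<theta> + B * G \<theta> / \<Lambda>"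
      using ewG \<Lambda> by (intro add_left_mono divide_right_mono) auto
    finally show "u \<theta> * w \<theta> \<le> (ln \<Lambda> - 1) * w \<theta> + B / \<Lambda> * G \<theta>" by simp
  qed
  also have "\<dots> = (ln \<Lambda> - 1) * (LINT \<theta>|lborel. w \<theta>) + b * \<tau> * (sqrt pi / 2)"
    using iw G B b by (subst Bochner_Integration.integral_add)
      (auto intro!: integrable_mult_right simp: \<Lambda>_def)
  \<comment> \<open>The kernel term is thus at most the integral of \<open>w\<close>, and this is
    what the \<open>- 1\<close> beside \<open>ln \<Lambda>\<close> cancels.\<close>
  also have "b * \<tau> * (sqrt pi / 2) \<le> b * \<tau> * 1"
    using b \<tau> pi_less_4 by (intro mult_left_mono) (auto intro!: real_le_lsqrt)
  also have "b * \<tau> * 1 \<le> (LINT \<theta>|lborel. w \<theta>)"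
    using Wb by (simp add: mult.commute)
  finally have "(LINT \<theta>|lborel. u \<theta> * w \<theta>) \<le> ln \<Lambda> * (LINT \<theta>|lborel. w \<theta>)"
    by (simp add: algebra_simps)
  then show "(LINT \<theta>|lborel. (\<theta> - y)\<^sup>2 * w \<theta>) \<le> 4 * \<tau>\<^sup>2 * ln (4 * B / b) * (LINT \<theta>|lborel. w \<theta>)"
    unfolding sq \<Lambda>_def[symmetric]
    by (simp del: mult_le_cancel_left_pos add: mult.assoc mult_left_mono)
qed

section \<open>Standardisation and moments of the normal law\<close>

lemma nn_integral_normal_affine:
  assumes [measurable]: "f \<in> borel_measurable borel" and \<sigma>: "0 < \<sigma>"
  shows "(\<integral>\<^sup>+x. f x \<partial>density lborel (\<lambda>x. ennreal (normal_density \<mu> \<sigma> x))) =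
    (\<integral>\<^sup>+z. f (\<mu> + \<sigma> * z) \<partial>density lborel (\<lambda>x. ennreal (std_normal_density x)))"
proof -
  have [simp]: "sqrt (2 * pi * \<sigma>\<^sup>2) = \<sigma> * sqrt (2 * pi)"
    using \<sigma> by (simp add: real_sqrt_mult)
  have d: "\<sigma> * normal_density \<mu> \<sigma> (\<mu> + \<sigma> * z) = std_normal_density z" for z
    using \<sigma> by (simp add: normal_density_def power_mult_distrib)
  have "(\<integral>\<^sup>+x. f x \<partial>density lborel (\<lambda>x. ennreal (normal_density \<mu> \<sigma> x))) =
      (\<integral>\<^sup>+x. ennreal (normal_density \<mu> \<sigma> x) * f x \<partial>lborel)"
    by (subst nn_integral_density) auto
  also have "\<dots> = ennreal \<sigma> * (\<integral>\<^sup>+z. ennreal (normal_density \<mu> \<sigma> (\<mu> + \<sigma> * z)) * f (\<mu> + \<sigma> * z) \<partial>lborel)"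
    using \<sigma> by (subst nn_integral_real_affine[where c = \<sigma> and t = \<mu>]) auto
  also have "\<dots> = (\<integral>\<^sup>+z. ennreal (std_normal_density z) * f (\<mu> + \<sigma> * z) \<partial>lborel)"
    using \<sigma> by (subst nn_integral_cmult[symmetric])
      (auto simp flip: ennreal_mult simp: mult.assoc[symmetric] d intro!: nn_integral_cong)
  also have "\<dots> = (\<integral>\<^sup>+z. f (\<mu> + \<sigma> * z) \<partial>density lborel (\<lambda>x. ennreal (std_normal_density x)))"
    by (subst nn_integral_density) auto
  finally show ?thesis .
qed

lemma std_normal_abs_moment:
  "\<exists>C\<ge>0. (\<integral>\<^sup>+z. ennreal (\<bar>z\<bar> ^ m) \<partial>density lborel (\<lambda>x. ennreal (std_normal_density x))) = ennreal C"
proof (intro exI conjI)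
  show "0 \<le> (LINT z|lborel. std_normal_density z * \<bar>z\<bar> ^ m)"
    by (intro integral_nonneg_AE) simp
  show "(\<integral>\<^sup>+z. ennreal (\<bar>z\<bar> ^ m) \<partial>density lborel (\<lambda>x. ennreal (std_normal_density x))) =
      ennreal (LINT z|lborel. std_normal_density z * \<bar>z\<bar> ^ m)"
    by (subst nn_integral_density)
       (auto simp flip: ennreal_mult intro!: nn_integral_eq_integral integrable_std_normal_moment_abs)
qed

text \<open>Since \<open>exp \<bar>z\<bar> \<le> exp z + exp (- z)\<close>, it suffices to tilt by
  \<open>exp (t * z)\<close> with \<open>t = 1\<close> and \<open>t = -1\<close>; completing the
  square gives a shifted normal density times \<open>exp (1 / 2)\<close>.\<close>

lemma std_normal_exp_abs_le:
  "(\<integral>\<^sup>+z. ennreal (exp \<bar>z\<bar>) \<partial>density lborel (\<lambda>x. ennreal (std_normal_density x))) \<le> ennreal (2 * exp (1 / 2))"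
proof -
  have d: "std_normal_density z * exp (t * z) = exp (t\<^sup>2 / 2) * normal_density t 1 z" for z t :: real
    by (simp add: normal_density_def field_simps power2_eq_square flip: exp_add)
  have i: "(\<integral>\<^sup>+z. ennreal (normal_density t 1 z) \<partial>lborel) = 1" for t
    by (subst nn_integral_eq_integral) (auto intro!: integrable_normal_density simp: integral_normal_density)
  have "(\<integral>\<^sup>+z. ennreal (exp \<bar>z\<bar>) \<partial>density lborel (\<lambda>x. ennreal (std_normal_density x))) \<le>
     (\<integral>\<^sup>+z. ennreal (std_normal_density z * exp (1 * z)) + ennreal (std_normal_density z * exp ((-1) * z)) \<partial>lborel)"
    by (subst nn_integral_density)
       (auto simp flip: ennreal_mult ennreal_plus simp: abs_if intro!: nn_integral_mono ennreal_leI)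
  also have "\<dots> = ennreal (2 * exp (1 / 2))"
    unfolding d
    by (subst nn_integral_add) (auto simp: ennreal_mult nn_integral_cmult i simp flip: ennreal_plus)
  finally show ?thesis .
qed

section \<open>Posterior risk of one coordinate\<close>

lemma power2_diff_le: "((a::real) - b)\<^sup>2 \<le> 2 * (a - d)\<^sup>2 + 2 * (d - b)\<^sup>2"
  using zero_le_power2[of "(a - d) - (d - b)"] by (simp add: power2_eq_square algebra_simps)

text \<open>The exponent of the logarithm in the tail condition is a natural number here, so that
  all logarithmic factors are ordinary powers; the real exponent of the theorem is rounded
  up.\<close>

locale tail_density =
  fixes h :: "real \<Rightarrow> real" and B c :: real and m :: nat
  assumes h_meas [measurable]: "h \<in> borel_measurable borel"
    and h_pos: "0 < h x"
    and h_le: "h x \<le> B"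
    and h_sym: "h (- x) = h x"
    and h_anti: "antimono_on {0..} h"
    and c_nonneg: "0 \<le> c"
    and h_tail: "0 \<le> x \<Longrightarrow> ln (1 / h x) \<le> c * (1 + ln (1 + x) ^ m)"
    and h_sq: "integrable lborel (\<lambda>x. x\<^sup>2 * h x)"
begin

lemma B_pos: "0 < B"
  using h_pos[of 0] h_le[of 0] by linarith

lemma h_abs_mono:
  assumes "\<bar>x\<bar> \<le> \<bar>y\<bar>"
  shows "h y \<le> h x"
proof -
  have "h \<bar>y\<bar> \<le> h \<bar>x\<bar>"
    using monotone_onD[OF h_anti, of "\<bar>x\<bar>" "\<bar>y\<bar>"] assms by simp
  then show ?thesis by (cases "x \<ge> 0"; cases "y \<ge> 0") (auto simp: h_sym)
qed

lemma h_ge_on_interval: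
  assumes "0 < s" "\<bar>\<theta> - y\<bar> \<le> \<tau>"
  shows "h ((\<bar>y\<bar> + \<tau>) / s) \<le> h (\<theta> / s)"
  using assms by (intro h_abs_mono) (auto simp: abs_mult intro!: divide_right_mono)

text \<open>In \<theta> the likelihood is a Gaussian kernel centred at the unregularised estimate
  \<open>x / q\<close>, with the noise level as its width. This is the shape to which
  \<open>gaussian_weight_concentration\<close> applies, with \<open>h (\<theta> / s)\<close> as the
  slowly varying weight.\<close>

lemma coord_weight_eq:
  assumes "0 < q" "0 < n"
  shows "coord_weight h s q n x = (\<lambda>\<theta>. exp (- ((\<theta> - x / q) / (1 / (sqrt (real n) * q)))\<^sup>2 / 2) * h (\<theta> / s))"
proof
  fix \<theta>
  have "(\<theta> - x / q) / (1 / (sqrt (real n) * q)) = sqrt (real n) * (q * \<theta> - x)"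
    using assms by (simp add: field_simps)
  then have "((\<theta> - x / q) / (1 / (sqrt (real n) * q)))\<^sup>2 = real n * (x - q * \<theta>)\<^sup>2"
    by (simp only: power_mult_distrib power2_commute[of "q * \<theta>"]) simp
  then show "coord_weight h s q n x \<theta> = exp (- ((\<theta> - x / q) / (1 / (sqrt (real n) * q)))\<^sup>2 / 2) * h (\<theta> / s)"
    by (simp add: coord_weight_def)
qed

lemma coord_weight_measurable [measurable]:
  "(\<lambda>(x, \<theta>). coord_weight h s q n x \<theta>) \<in> borel_measurable (borel \<Otimes>\<^sub>M borel)"
  "coord_weight h s q n x \<in> borel_measurable borel"
  unfolding coord_weight_def by measurable

lemma coord_weight_pos: "0 < coord_weight h s q n x \<theta>"
  by (simp add: coord_weight_def h_pos)

context
  fixes s q :: real and n :: nat and \<tau> :: real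
  assumes s: "0 < s" and q: "0 < q" and n: "0 < n"
  defines "\<tau> \<equiv> 1 / (sqrt (real n) * q)"
begin

lemma \<tau>_pos: "0 < \<tau>"
  using q n by (simp add: \<tau>_def)

lemma weight_concentration:
  fixes x :: real
  defines "w \<equiv> coord_weight h s q n x"
  shows "integrable lborel w"
    and "integrable lborel (\<lambda>\<theta>. (\<theta> - x / q)\<^sup>2 * w \<theta>)"
    and "\<tau> * h ((\<bar>x / q\<bar> + \<tau>) / s) \<le> (LINT \<theta>|lborel. w \<theta>)"
    and "(LINT \<theta>|lborel. (\<theta> - x / q)\<^sup>2 * w \<theta>) \<le>
      4 * \<tau>\<^sup>2 * ln (4 * B / h ((\<bar>x / q\<bar> + \<tau>) / s)) * (LINT \<theta>|lborel. w \<theta>)"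
  unfolding w_def coord_weight_eq[OF q n, folded \<tau>_def]
  by (rule gaussian_weight_concentration[OF _ less_imp_le[OF h_pos] h_le \<tau>_pos h_pos h_ge_on_interval[OF s]];
      simp)+

lemma coord_weight_integrable: "integrable lborel (coord_weight h s q n x)"
  by (rule weight_concentration(1))

lemma coord_weight_integral_pos: "0 < (LINT \<theta>|lborel. coord_weight h s q n x \<theta>)"
  using weight_concentration(3)[of x] \<tau>_pos h_pos[of "(\<bar>x / q\<bar> + \<tau>) / s"]
  by (smt (verit, best) mult_pos_pos)

lemma nn_integral_coord_posterior:
  assumes [measurable]: "f \<in> borel_measurable borel" and f: "\<And>\<theta>. 0 \<le> f \<theta>"
    and i: "integrable lborel (\<lambda>\<theta>. f \<theta> * coord_weight h s q n x \<theta>)"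
  shows "(\<integral>\<^sup>+\<theta>. ennreal (f \<theta>) \<partial>coord_posterior h s q n x) =
    ennreal ((LINT \<theta>|lborel. f \<theta> * coord_weight h s q n x \<theta>) / (LINT \<theta>|lborel. coord_weight h s q n x \<theta>))"
proof -
  let ?W = "LINT \<theta>|lborel. coord_weight h s q n x \<theta>"
  have "(\<integral>\<^sup>+\<theta>. ennreal (f \<theta>) \<partial>coord_posterior h s q n x) =
      (\<integral>\<^sup>+\<theta>. ennreal (f \<theta> * coord_weight h s q n x \<theta> / ?W) \<partial>lborel)"
    unfolding coord_posterior_def
  proof (subst nn_integral_density)
    show "(\<integral>\<^sup>+\<theta>. ennreal (coord_weight h s q n x \<theta> / ?W) * ennreal (f \<theta>) \<partial>lborel) =
        (\<integral>\<^sup>+\<theta>. ennreal (f \<theta> * coord_weight h s q n x \<theta> / ?W) \<partial>lborel)"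
      by (subst ennreal_mult''[symmetric]) (use f in \<open>simp_all add: mult.commute\<close>)
  qed measurable
  also have "\<dots> = ennreal (LINT \<theta>|lborel. f \<theta> * coord_weight h s q n x \<theta> / ?W)"
    using f coord_weight_integral_pos[of x] less_imp_le[OF coord_weight_pos]
    by (intro nn_integral_eq_integral integrable_divide_zero i) auto
  finally show ?thesis by simp
qed

lemma prob_space_coord_posterior: "prob_space (coord_posterior h s q n x)"
proof
  have "emeasure (coord_posterior h s q n x) (space (coord_posterior h s q n x)) =
      (\<integral>\<^sup>+\<theta>. ennreal 1 \<partial>coord_posterior h s q n x)" by simp
  also have "\<dots> = 1"
    using coord_weight_integral_pos[of x] coord_weight_integrable
    by (subst nn_integral_coord_posterior) auto
  finally show "emeasure (coord_posterior h s q n x) (space (coord_posterior h s q n x)) = 1" .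
qed

lemma posterior_risk_measurable [measurable]:
  "(\<lambda>x. \<integral>\<^sup>+\<theta>. ennreal ((\<theta> - f)\<^sup>2) \<partial>coord_posterior h s q n x) \<in> borel_measurable borel"
proof -
  have [measurable]: "(\<lambda>x. LINT \<theta>|lborel. coord_weight h s q n x \<theta>) \<in> borel_measurable borel"
    by (intro lborel.borel_measurable_lebesgue_integral) measurable
  have "(\<lambda>x. \<integral>\<^sup>+\<theta>. ennreal ((\<theta> - f)\<^sup>2) \<partial>coord_posterior h s q n x) =
    (\<lambda>x. \<integral>\<^sup>+\<theta>. ennreal (coord_weight h s q n x \<theta> / (LINT \<theta>|lborel. coord_weight h s q n x \<theta>)) * ennreal ((\<theta> - f)\<^sup>2) \<partial>lborel)"
    unfolding coord_posterior_def by (subst nn_integral_density) auto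
  also have "\<dots> \<in> borel_measurable borel"
    by (intro lborel.borel_measurable_nn_integral) measurable
  finally show ?thesis .
qed

lemma posterior_risk_shift:
  "(\<integral>\<^sup>+\<theta>. ennreal ((\<theta> - f)\<^sup>2) \<partial>coord_posterior h s q n x) \<le>
    2 * (\<integral>\<^sup>+\<theta>. ennreal ((\<theta> - y)\<^sup>2) \<partial>coord_posterior h s q n x) + ennreal (2 * (y - f)\<^sup>2)"
proof -
  interpret P: prob_space "coord_posterior h s q n x" by (rule prob_space_coord_posterior)
  have [measurable_cong, simp]: "sets (coord_posterior h s q n x) = sets borel"
    by (simp add: coord_posterior_def)
  have "(\<integral>\<^sup>+\<theta>. ennreal ((\<theta> - f)\<^sup>2) \<partial>coord_posterior h s q n x) \<le>
      (\<integral>\<^sup>+\<theta>. 2 * ennreal ((\<theta> - y)\<^sup>2) + ennreal (2 * (y - f)\<^sup>2) \<partial>coord_posterior h s q n x)"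
  proof (rule nn_integral_mono)
    fix \<theta>
    have "ennreal ((\<theta> - f)\<^sup>2) \<le> ennreal (2 * (\<theta> - y)\<^sup>2 + 2 * (y - f)\<^sup>2)"
      by (intro ennreal_leI power2_diff_le)
    then show "ennreal ((\<theta> - f)\<^sup>2) \<le> 2 * ennreal ((\<theta> - y)\<^sup>2) + ennreal (2 * (y - f)\<^sup>2)"
      by (simp add: ennreal_mult)
  qed
  also have "\<dots> = 2 * (\<integral>\<^sup>+\<theta>. ennreal ((\<theta> - y)\<^sup>2) \<partial>coord_posterior h s q n x) + ennreal (2 * (y - f)\<^sup>2)"
    by (subst nn_integral_add) (auto simp: nn_integral_cmult P.emeasure_space_1)
  finally show ?thesis .
qed

text \<open>The risk is split at \<open>x / q\<close>. The spread around \<open>x / q\<close> costs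
  \<open>ln (4 * B / b)\<close>, where \<open>b\<close> is the value of \<open>h\<close> at the
  largest modulus that occurs within distance \<tau> of \<open>x / q\<close>; the tail condition
  turns \<open>ln (1 / b)\<close> into a power of a logarithm, so a small \<open>s\<close> is felt
  only through \<open>ln (1 / s)\<close>.\<close>

lemma posterior_risk_le:
  "(\<integral>\<^sup>+\<theta>. ennreal ((\<theta> - f)\<^sup>2) \<partial>coord_posterior h s q n x) \<le>
    ennreal (8 * \<tau>\<^sup>2 * (\<bar>ln (4 * B)\<bar> + c * (1 + ln (1 + (\<bar>x / q\<bar> + \<tau>) / s) ^ m)) + 2 * (x / q - f)\<^sup>2)"
proof -
  let ?b = "h ((\<bar>x / q\<bar> + \<tau>) / s)" and ?W = "LINT \<theta>|lborel. coord_weight h s q n x \<theta>"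
  let ?l = "\<bar>ln (4 * B)\<bar> + c * (1 + ln (1 + (\<bar>x / q\<bar> + \<tau>) / s) ^ m)"
  have l0: "0 \<le> (\<bar>x / q\<bar> + \<tau>) / s"
    using s \<tau>_pos by simp
  have l: "ln (4 * B / ?b) \<le> ?l" "0 \<le> ?l"
  proof -
    have "ln (4 * B / ?b) = ln (4 * B) + ln (1 / ?b)"
      using B_pos h_pos[of "(\<bar>x / q\<bar> + \<tau>) / s"] by (simp only: ln_div ln_mult) auto
    then show "ln (4 * B / ?b) \<le> ?l"
      using h_tail[OF l0] by linarith
    show "0 \<le> ?l"
      using l0 c_nonneg by (intro add_nonneg_nonneg mult_nonneg_nonneg) auto
  qed
  have "(LINT \<theta>|lborel. (\<theta> - x / q)\<^sup>2 * coord_weight h s q n x \<theta>) \<le> 4 * \<tau>\<^sup>2 * ln (4 * B / ?b) * ?W"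
    by (rule weight_concentration(4))
  also have "\<dots> \<le> 4 * \<tau>\<^sup>2 * ?l * ?W"
    using l coord_weight_integral_pos[of x] by (intro mult_right_mono mult_left_mono) auto
  finally have "(LINT \<theta>|lborel. (\<theta> - x / q)\<^sup>2 * coord_weight h s q n x \<theta>) / ?W \<le> 4 * \<tau>\<^sup>2 * ?l"
    using coord_weight_integral_pos[of x] by (simp add: field_simps)
  then have "(\<integral>\<^sup>+\<theta>. ennreal ((\<theta> - x / q)\<^sup>2) \<partial>coord_posterior h s q n x) \<le> ennreal (4 * \<tau>\<^sup>2 * ?l)"
    by (subst nn_integral_coord_posterior) (auto intro!: weight_concentration(2) ennreal_leI)
  then have "2 * (\<integral>\<^sup>+\<theta>. ennreal ((\<theta> - x / q)\<^sup>2) \<partial>coord_posterior h s q n x) \<le> ennreal (2 * (4 * \<tau>\<^sup>2 * ?l))"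
    by (metis ennreal_mult' ennreal_numeral mult_left_mono zero_le zero_le_numeral)
  then have "(\<integral>\<^sup>+\<theta>. ennreal ((\<theta> - f)\<^sup>2) \<partial>coord_posterior h s q n x) \<le>
      ennreal (2 * (4 * \<tau>\<^sup>2 * ?l)) + ennreal (2 * (x / q - f)\<^sup>2)"
    by (intro order_trans[OF posterior_risk_shift[where f = f and x = x and y = "x / q"]] add_right_mono)
  also have "\<dots> = ennreal (8 * \<tau>\<^sup>2 * ?l + 2 * (x / q - f)\<^sup>2)"
    using l(2) by (subst ennreal_plus[symmetric]) auto
  finally show ?thesis .
qed

text \<open>
  By symmetry of \<open>h\<close> the factor \<open>exp (n x q \<theta>)\<close> of the likelihood may be replaced by its
  hyperbolic cosine, so that the bound carries the Gaussian factor of a signal-free observation.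
\<close>

lemma coord_weight_integral_lower:
  assumes C: "s \<le> C * \<tau>"
  shows "2 * s * exp (- (real n * x\<^sup>2 / 2)) * exp (- (C\<^sup>2 / 2)) * h 1 \<le> (LINT \<theta>|lborel. coord_weight h s q n x \<theta>)"
proof -
  let ?w = "coord_weight h s q n x"
  define k where "k = 2 * exp (- (real n * x\<^sup>2 / 2)) * exp (- (C\<^sup>2 / 2)) * h 1"
  have k: "0 < k" by (simp add: k_def h_pos)
  have im: "integrable lborel (\<lambda>\<theta>. ?w (- \<theta>))"
    using lborel_integrable_real_affine[OF coord_weight_integrable[of x], of "-1" 0] by simp
  have "2 * s * k = (LINT \<theta>|lborel. k * indicator {- s..s} \<theta>)"
    using s by simp
  also have "\<dots> \<le> (LINT \<theta>|lborel. ?w \<theta> + ?w (- \<theta>))"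
  proof (rule integral_mono)
    show "integrable lborel (\<lambda>\<theta>. k * indicator {- s..s} \<theta> :: real)"
      by (intro integrable_mult_right integrable_real_indicator) (auto simp: emeasure_lborel_Icc_eq)
    show "integrable lborel (\<lambda>\<theta>. ?w \<theta> + ?w (- \<theta>))"
      by (intro Bochner_Integration.integrable_add coord_weight_integrable im)
    fix \<theta>
    show "k * indicator {- s..s} \<theta> \<le> ?w \<theta> + ?w (- \<theta>)"
    proof (cases "\<theta> \<in> {- s..s}")
      case True
      then have a: "\<bar>\<theta>\<bar> \<le> s" by auto
      \<comment> \<open>Here the prior scale is below the noise: on \<open>[- s, s]\<close> the
        quadratic part of the exponent stays bounded, so the likelihood is flat there apart from the
        cross term \<open>t\<close>.\<close>
      have "\<bar>sqrt (real n) * q * \<theta>\<bar> \<le> sqrt (real n) * q * s"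
        using a q by (simp add: abs_mult mult_left_mono)
      also have "\<dots> \<le> C"
        using C q n by (simp add: \<tau>_def field_simps)
      finally have "(sqrt (real n) * q * \<theta>)\<^sup>2 \<le> C\<^sup>2"
        by (rule abs_le_square_iff[THEN iffD1, OF order_trans]) simp
      then have e: "real n * (q * \<theta>)\<^sup>2 \<le> C\<^sup>2"
        by (simp add: power_mult_distrib)
      have h1: "h 1 \<le> h (\<theta> / s)" using a s by (intro h_abs_mono) simp
      define t where "t = real n * x * q * \<theta>"
      have "2 \<le> exp t + exp (- t)"
        using cosh_real_ge_1[of t] by (simp add: cosh_def)
      then have "exp (- (real n * x\<^sup>2 / 2)) * exp (- (C\<^sup>2 / 2)) * 2 * h 1 \<le>
         exp (- (real n * x\<^sup>2 / 2)) * exp (- (real n * (q * \<theta>)\<^sup>2 / 2)) * (exp t + exp (- t)) * h (\<theta> / s)"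
        using e h1 less_imp_le[OF h_pos] by (intro mult_mono) auto
      also have "\<dots> = exp (- (real n * x\<^sup>2 / 2) + - (real n * (q * \<theta>)\<^sup>2 / 2) + t) * h (\<theta> / s) +
          exp (- (real n * x\<^sup>2 / 2) + - (real n * (q * \<theta>)\<^sup>2 / 2) + - t) * h (\<theta> / s)"
        unfolding exp_add by (simp add: algebra_simps)
      also have "\<dots> = ?w \<theta> + ?w (- \<theta>)"
      proof -
        have "- (real n * x\<^sup>2 / 2) + - (real n * (q * \<theta>)\<^sup>2 / 2) + t = - (real n * (x - q * \<theta>)\<^sup>2 / 2)"
          "- (real n * x\<^sup>2 / 2) + - (real n * (q * \<theta>)\<^sup>2 / 2) + - t = - (real n * (x - q * (- \<theta>))\<^sup>2 / 2)"
          by (simp_all add: t_def power2_eq_square field_simps)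
        then show ?thesis by (simp only: coord_weight_def) (simp add: h_sym)
      qed
      finally show ?thesis using True by (simp add: k_def)
    qed (use less_imp_le[OF coord_weight_pos] in auto)
  qed
  also have "\<dots> = 2 * (LINT \<theta>|lborel. ?w \<theta>)"
    using lborel_integral_real_affine[of "-1" ?w 0]
    by (subst Bochner_Integration.integral_add) (auto intro: coord_weight_integrable im)
  finally show ?thesis by (simp add: k_def mult_ac)
qed

end

text \<open>The constant is uniform in all four parameters. With
  \<open>x / q = f + \<tau> * z\<close> for a standard normal \<open>z\<close>, the logarithm in
  \<open>posterior_risk_le\<close> is at most \<open>l + \<bar>z\<bar>\<close>, so the observation
  contributes only the absolute moments of \<open>z\<close> of orders \<open>m\<close> and
  2.\<close>

lemma averaged_posterior_risk:
  "\<exists>C\<ge>0. \<forall>s q n f. 0 < s \<longrightarrow> 0 < q \<longrightarrow> 0 < n \<longrightarrow>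
    (\<integral>\<^sup>+x. (\<integral>\<^sup>+\<theta>. ennreal ((\<theta> - f)\<^sup>2) \<partial>coord_posterior h s q n x)
      \<partial>density lborel (\<lambda>x. ennreal (normal_density (q * f) (1 / sqrt (real n)) x)))
    \<le> ennreal (C * (1 / (sqrt (real n) * q))\<^sup>2 * (1 + ln (1 + (\<bar>f\<bar> + 1 / (sqrt (real n) * q)) / s) ^ m))"
proof -
  let ?N = "density lborel (\<lambda>x. ennreal (std_normal_density x))"
  interpret N: prob_space ?N by (rule prob_space_normal_density) simp
  obtain M where M: "0 \<le> M" "(\<integral>\<^sup>+z. ennreal (\<bar>z\<bar> ^ m) \<partial>?N) = ennreal M"
    using std_normal_abs_moment by blast
  obtain M2 where M2: "0 \<le> M2" "(\<integral>\<^sup>+z. ennreal (\<bar>z\<bar> ^ 2) \<partial>?N) = ennreal M2"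
    using std_normal_abs_moment by blast
  define D where "D = \<bar>ln (4 * B)\<bar>"
  define C where "C = 8 * D + 8 * c + 8 * c * 2 ^ m + 8 * c * 2 ^ m * M + 2 * M2"
  have D: "0 \<le> D" by (simp add: D_def)
  show ?thesis
  proof (intro exI[of _ C] conjI allI impI)
    show "0 \<le> C" using D c_nonneg M M2 by (simp add: C_def)
    fix s q f :: real and n :: nat
    assume s: "0 < s" and q: "0 < q" and n: "0 < n"
    define \<tau> where "\<tau> = 1 / (sqrt (real n) * q)"
    define l where "l = ln (1 + (\<bar>f\<bar> + \<tau>) / s)"
    have \<tau>: "0 < \<tau>" using q n by (simp add: \<tau>_def)
    then have A: "0 \<le> (\<bar>f\<bar> + \<tau>) / s" using s by simp
    then have l: "0 \<le> l" by (simp add: l_def)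
    have pw: "(\<integral>\<^sup>+\<theta>. ennreal ((\<theta> - f)\<^sup>2) \<partial>coord_posterior h s q n (q * f + 1 / sqrt n * z)) \<le>
       ennreal (\<tau>\<^sup>2 * (8 * D + 8 * c + 8 * c * 2 ^ m * l ^ m)) +
       (ennreal (\<tau>\<^sup>2 * (8 * c * 2 ^ m)) * ennreal (\<bar>z\<bar> ^ m) + ennreal (\<tau>\<^sup>2 * 2) * ennreal (\<bar>z\<bar> ^ 2))" for z
    proof -
      let ?x = "q * f + 1 / sqrt n * z"
      have y: "?x / q = f + \<tau> * z" using q n by (simp add: \<tau>_def field_simps)
      \<comment> \<open>Dominating by a product with factor \<open>1 + \<bar>z\<bar>\<close> makes
        the noise an additive term of the logarithm, free of \<open>f\<close>, \<tau> and
        \<open>s\<close>.\<close>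
      have "1 + (\<bar>f + \<tau> * z\<bar> + \<tau>) / s \<le> 1 + (\<bar>f\<bar> + \<tau>) * (1 + \<bar>z\<bar>) / s"
      proof -
        have "\<bar>f + \<tau> * z\<bar> \<le> \<bar>f\<bar> + \<tau> * \<bar>z\<bar>"
          using abs_triangle_ineq[of f "\<tau> * z"] \<tau> by (simp add: abs_mult)
        also have "\<dots> + \<tau> \<le> (\<bar>f\<bar> + \<tau>) * (1 + \<bar>z\<bar>)"
          by (simp add: algebra_simps)
        finally show ?thesis using s by (simp add: divide_right_mono)
      qed
      also have "\<dots> \<le> (1 + (\<bar>f\<bar> + \<tau>) / s) * (1 + \<bar>z\<bar>)"
        by (simp add: algebra_simps add_divide_distrib)
      finally have "ln (1 + (\<bar>f + \<tau> * z\<bar> + \<tau>) / s) \<le> ln ((1 + (\<bar>f\<bar> + \<tau>) / s) * (1 + \<bar>z\<bar>))"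
        using s \<tau> by (intro ln_mono) (auto intro!: add_pos_nonneg divide_nonneg_pos add_nonneg_nonneg)
      also have "\<dots> = l + ln (1 + \<bar>z\<bar>)"
        using A by (simp add: ln_mult l_def)
      also have "\<dots> \<le> l + \<bar>z\<bar>" by (simp add: ln_add_one_self_le_self)
      finally have L: "ln (1 + (\<bar>f + \<tau> * z\<bar> + \<tau>) / s) \<le> l + \<bar>z\<bar>" .
      have L0: "0 \<le> ln (1 + (\<bar>f + \<tau> * z\<bar> + \<tau>) / s)"
        using s \<tau> by simp
      have "ln (1 + (\<bar>f + \<tau> * z\<bar> + \<tau>) / s) ^ m \<le> (2 * max l \<bar>z\<bar>) ^ m"
        using L L0 by (intro power_mono) auto
      also have "\<dots> \<le> 2 ^ m * (l ^ m + \<bar>z\<bar> ^ m)"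
        using l by (auto simp: power_mult_distrib max_def)
      finally have Lm: "ln (1 + (\<bar>f + \<tau> * z\<bar> + \<tau>) / s) ^ m \<le> 2 ^ m * (l ^ m + \<bar>z\<bar> ^ m)" .
      have "8 * \<tau>\<^sup>2 * (D + c * (1 + ln (1 + (\<bar>f + \<tau> * z\<bar> + \<tau>) / s) ^ m)) + 2 * (f + \<tau> * z - f)\<^sup>2 \<le>
        8 * \<tau>\<^sup>2 * (D + c * (1 + 2 ^ m * (l ^ m + \<bar>z\<bar> ^ m))) + 2 * (f + \<tau> * z - f)\<^sup>2"
        using Lm c_nonneg by (intro add_right_mono mult_left_mono add_left_mono) auto
      also have "\<dots> = \<tau>\<^sup>2 * (8 * D + 8 * c + 8 * c * 2 ^ m * l ^ m) +
         (\<tau>\<^sup>2 * (8 * c * 2 ^ m) * \<bar>z\<bar> ^ m + \<tau>\<^sup>2 * 2 * \<bar>z\<bar> ^ 2)"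
        by (simp add: algebra_simps power_mult_distrib)
      finally have le: "8 * \<tau>\<^sup>2 * (D + c * (1 + ln (1 + (\<bar>f + \<tau> * z\<bar> + \<tau>) / s) ^ m)) + 2 * (f + \<tau> * z - f)\<^sup>2 \<le> \<dots>" .
      have nn: "0 \<le> \<tau>\<^sup>2 * (8 * D + 8 * c + 8 * c * 2 ^ m * l ^ m)" "0 \<le> \<tau>\<^sup>2 * (8 * c * 2 ^ m) * \<bar>z\<bar> ^ m"
          "0 \<le> \<tau>\<^sup>2 * 2 * \<bar>z\<bar> ^ 2" "0 \<le> \<tau>\<^sup>2 * (8 * c * 2 ^ m)" "0 \<le> \<tau>\<^sup>2 * 2"
        using D c_nonneg l by auto
      show ?thesis
        using order_trans[OF posterior_risk_le[OF s q n, of ?x f, folded \<tau>_def D_def, unfolded y] ennreal_leI[OF le]] nn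
        by (simp only: ennreal_plus ennreal_mult add_nonneg_nonneg zero_le_power zero_le_power2 abs_ge_zero)
    qed
    have "(\<integral>\<^sup>+x. (\<integral>\<^sup>+\<theta>. ennreal ((\<theta> - f)\<^sup>2) \<partial>coord_posterior h s q n x)
        \<partial>density lborel (\<lambda>x. ennreal (normal_density (q * f) (1 / sqrt (real n)) x))) =
      (\<integral>\<^sup>+z. (\<integral>\<^sup>+\<theta>. ennreal ((\<theta> - f)\<^sup>2) \<partial>coord_posterior h s q n (q * f + 1 / sqrt n * z)) \<partial>?N)"
      using n by (intro nn_integral_normal_affine posterior_risk_measurable s q n) simp
    also have "\<dots> \<le> (\<integral>\<^sup>+z. ennreal (\<tau>\<^sup>2 * (8 * D + 8 * c + 8 * c * 2 ^ m * l ^ m)) +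
       (ennreal (\<tau>\<^sup>2 * (8 * c * 2 ^ m)) * ennreal (\<bar>z\<bar> ^ m) + ennreal (\<tau>\<^sup>2 * 2) * ennreal (\<bar>z\<bar> ^ 2)) \<partial>?N)"
      by (intro nn_integral_mono pw)
    also have "\<dots> = ennreal (\<tau>\<^sup>2 * (8 * D + 8 * c + 8 * c * 2 ^ m * l ^ m)) +
       (ennreal (\<tau>\<^sup>2 * (8 * c * 2 ^ m)) * ennreal M + ennreal (\<tau>\<^sup>2 * 2) * ennreal M2)"
      unfolding M(2)[symmetric] M2(2)[symmetric]
      by (subst nn_integral_add; simp)
         (subst nn_integral_add; simp add: nn_integral_cmult N.emeasure_space_1[simplified])
    also have "\<dots> = ennreal (\<tau>\<^sup>2 * (8 * D + 8 * c + 8 * c * 2 ^ m * l ^ m) + (\<tau>\<^sup>2 * (8 * c * 2 ^ m) * M + \<tau>\<^sup>2 * 2 * M2))"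
      using D c_nonneg M(1) M2(1) l by (simp only: ennreal_plus ennreal_mult add_nonneg_nonneg mult_nonneg_nonneg zero_le_power zero_le_power2 abs_ge_zero zero_le_numeral)
    also have "\<dots> \<le> ennreal (C * \<tau>\<^sup>2 * (1 + l ^ m))"
    proof (rule ennreal_leI)
      have "(8 * D + 8 * c + 8 * c * 2 ^ m * l ^ m) + (8 * c * 2 ^ m * M + 2 * M2) \<le> C * 1 + C * l ^ m"
      proof -
        have "8 * c * 2 ^ m * l ^ m \<le> C * l ^ m"
          using D c_nonneg M(1) M2(1) l by (intro mult_right_mono) (auto simp: C_def)
        moreover have "0 \<le> 8 * c * 2 ^ m" using c_nonneg by simp
        ultimately show ?thesis by (simp add: C_def)
      qed
      then have "\<tau>\<^sup>2 * ((8 * D + 8 * c + 8 * c * 2 ^ m * l ^ m) + (8 * c * 2 ^ m * M + 2 * M2)) \<le> \<tau>\<^sup>2 * (C * 1 + C * l ^ m)"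
        by (rule mult_left_mono) simp
      then show "\<tau>\<^sup>2 * (8 * D + 8 * c + 8 * c * 2 ^ m * l ^ m) + (\<tau>\<^sup>2 * (8 * c * 2 ^ m) * M + \<tau>\<^sup>2 * 2 * M2) \<le> C * \<tau>\<^sup>2 * (1 + l ^ m)"
        by (simp add: algebra_simps)
    qed
    finally show "(\<integral>\<^sup>+x. (\<integral>\<^sup>+\<theta>. ennreal ((\<theta> - f)\<^sup>2) \<partial>coord_posterior h s q n x)
      \<partial>density lborel (\<lambda>x. ennreal (normal_density (q * f) (1 / sqrt (real n)) x)))
      \<le> ennreal (C * (1 / (sqrt (real n) * q))\<^sup>2 * (1 + ln (1 + (\<bar>f\<bar> + 1 / (sqrt (real n) * q)) / s) ^ m))"
      unfolding \<tau>_def l_def .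
  qed
qed

text \<open>
  The evidence is at least a constant times the density of a pure noise observation. On the
  truncation event the true density of the observation exceeds that one by at most a factor
  \<open>exp 1\<close>; it cancels, and integrating out the observation leaves the prior second moment.
\<close>

lemma truncated_posterior_risk:
  assumes s: "0 < s" and q: "0 < q" and n: "0 < n"
    and C: "s \<le> C * (1 / (sqrt (real n) * q))"
    and T: "sqrt (real n) * q * \<bar>f\<bar> * T \<le> 1" "0 \<le> T"
  shows "(\<integral>\<^sup>+x. indicator {x. \<bar>sqrt (real n) * x\<bar> \<le> T} x *
      (\<integral>\<^sup>+\<theta>. ennreal ((\<theta> - f)\<^sup>2) \<partial>coord_posterior h s q n x)
      \<partial>density lborel (\<lambda>x. ennreal (normal_density (q * f) (1 / sqrt (real n)) x)))
    \<le> ennreal (exp (1 + C\<^sup>2 / 2) / h 1 * (LINT x|lborel. x\<^sup>2 * h x) * s\<^sup>2 + 2 * f\<^sup>2)"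
proof -
  define nd where "nd \<mu> x = normal_density \<mu> (1 / sqrt (real n)) x" for \<mu> x
  let ?N = "density lborel (\<lambda>x. ennreal (nd (q * f) x))"
  let ?I = "indicator {x. \<bar>sqrt (real n) * x\<bar> \<le> T} :: real \<Rightarrow> ennreal"
  define M where "M = (LINT x|lborel. x\<^sup>2 * h x)"
  \<comment> \<open>The factor \<open>exp 1\<close> lost by truncation, divided by the constants in
    \<open>coord_weight_integral_lower\<close>.\<close>
  define K where "K = exp (1 + C\<^sup>2 / 2) / (2 * s * h 1)"
  have K: "0 < K" using s h_pos[of 1] by (simp add: K_def)
  have [measurable]: "(\<lambda>(\<mu>, x). nd \<mu> x) \<in> borel_measurable (borel \<Otimes>\<^sub>M borel)" "nd \<mu> \<in> borel_measurable borel" for \<mu>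
    unfolding nd_def normal_density_def by measurable
  have nd0: "0 \<le> nd \<mu> x" for \<mu> x by (simp add: nd_def)
  have nd1: "(\<integral>\<^sup>+x. ennreal (nd \<mu> x) \<partial>lborel) = 1" for \<mu>
    using n unfolding nd_def
    by (subst nn_integral_eq_integral) (auto intro!: integrable_normal_density simp: integral_normal_density)
  interpret N: prob_space ?N
    unfolding nd_def using n by (intro prob_space_normal_density) simp
  define R where "R a x = (\<integral>\<^sup>+\<theta>. ennreal ((\<theta> - a)\<^sup>2) \<partial>coord_posterior h s q n x)" for a x
  have [measurable]: "R a \<in> borel_measurable borel" for a
    unfolding R_def by (intro posterior_risk_measurable s q n)
  \<comment> \<open>Dividing by the evidence has turned the true density into a constant: what
    remains under the integral is, up to that constant, the joint density of parameter and
    observation, whose \<open>x\<close>-integral is elementary after exchanging the order.\<close>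
  have pw: "ennreal (nd (q * f) x) * (?I x * R 0 x) \<le>
      (\<integral>\<^sup>+\<theta>. ennreal (K * (\<theta>\<^sup>2 * h (\<theta> / s)) * nd (q * \<theta>) x) \<partial>lborel)" for x
  proof (cases "\<bar>sqrt (real n) * x\<bar> \<le> T")
    case True
    let ?W = "LINT \<theta>|lborel. coord_weight h s q n x \<theta>"
    have W: "0 < ?W" by (rule coord_weight_integral_pos[OF s q n])
    have "real n * x * (q * f) \<le> (\<bar>sqrt (real n) * x\<bar>) * (sqrt (real n) * q * \<bar>f\<bar>)"
    proof -
      have "real n * x * (q * f) \<le> \<bar>real n * x * (q * f)\<bar>" by simp
      also have "\<dots> = (sqrt (real n) * sqrt (real n)) * \<bar>x\<bar> * (q * \<bar>f\<bar>)"
        using q by (simp add: abs_mult)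
      finally show ?thesis by (simp add: abs_mult algebra_simps)
    qed
    also have "\<dots> \<le> T * (sqrt (real n) * q * \<bar>f\<bar>)"
      using True q by (intro mult_right_mono) auto
    also have "\<dots> \<le> 1" using T by (simp add: mult.commute)
    finally have "real n * x * (q * f) \<le> 1" .
    moreover have "real n * (x - q * f)\<^sup>2 = real n * x\<^sup>2 + real n * (q * f)\<^sup>2 - 2 * (real n * x * (q * f))"
      by (simp add: power2_eq_square algebra_simps)
    moreover have "0 \<le> real n * (q * f)\<^sup>2" by simp
    ultimately have ex: "- (real n * (x - q * f)\<^sup>2 / 2) \<le> 1 + - (real n * x\<^sup>2 / 2)"
      by linarith
    have main: "nd (q * f) x * (\<theta>\<^sup>2 * coord_weight h s q n x \<theta> / ?W) \<le> K * (\<theta>\<^sup>2 * h (\<theta> / s)) * nd (q * \<theta>) x" for \<theta>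
    proof -
      define d where "d = 1 / sqrt (2 * pi * (1 / sqrt (real n))\<^sup>2)"
      have nd: "nd \<mu> x = d * exp (- (real n * (x - \<mu>)\<^sup>2 / 2))" for \<mu>
        using n by (simp add: nd_def normal_density_def power_divide d_def)
      have d: "0 \<le> d" by (simp add: d_def)
      have "exp (- (real n * (x - q * f)\<^sup>2 / 2)) \<le> exp (1 + - (real n * x\<^sup>2 / 2))"
        using ex by (rule exp_le_cancel_iff[THEN iffD2])
      also have "\<dots> = K * (2 * s * exp (- (real n * x\<^sup>2 / 2)) * exp (- (C\<^sup>2 / 2)) * h 1)"
      proof -
        have "K * (2 * s * exp (- (real n * x\<^sup>2 / 2)) * exp (- (C\<^sup>2 / 2)) * h 1) =
            exp (1 + C\<^sup>2 / 2) * exp (- (C\<^sup>2 / 2)) * exp (- (real n * x\<^sup>2 / 2))"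
          using s h_pos[of 1] by (simp add: K_def)
        then show ?thesis by (simp flip: exp_add)
      qed
      also have "\<dots> \<le> K * ?W"
        using coord_weight_integral_lower[OF s q n C, of x] K by (intro mult_left_mono) auto
      finally have "exp (- (real n * (x - q * f)\<^sup>2 / 2)) / ?W \<le> K"
        using W by (simp add: field_simps)
      then have "(d * (\<theta>\<^sup>2 * coord_weight h s q n x \<theta>)) * (exp (- (real n * (x - q * f)\<^sup>2 / 2)) / ?W) \<le>
          (d * (\<theta>\<^sup>2 * coord_weight h s q n x \<theta>)) * K"
        using d less_imp_le[OF coord_weight_pos] by (intro mult_left_mono) auto
      then show ?thesis
        unfolding nd coord_weight_def by (simp only: mult_ac times_divide_eq_right times_divide_eq_left)
    qed
    have "ennreal (nd (q * f) x) * R 0 x =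
        (\<integral>\<^sup>+\<theta>. ennreal (nd (q * f) x) * (ennreal (coord_weight h s q n x \<theta> / ?W) * ennreal (\<theta>\<^sup>2)) \<partial>lborel)"
      unfolding coord_posterior_def R_def by (subst nn_integral_density) (auto simp: nn_integral_cmult)
    also have "\<dots> \<le> (\<integral>\<^sup>+\<theta>. ennreal (K * (\<theta>\<^sup>2 * h (\<theta> / s)) * nd (q * \<theta>) x) \<partial>lborel)"
    proof (rule nn_integral_mono)
      fix \<theta>
      have "ennreal (nd (q * f) x) * (ennreal (coord_weight h s q n x \<theta> / ?W) * ennreal (\<theta>\<^sup>2)) =
          ennreal (nd (q * f) x * (\<theta>\<^sup>2 * coord_weight h s q n x \<theta> / ?W))"
        using nd0 W less_imp_le[OF coord_weight_pos] by (simp add: ennreal_mult[symmetric] mult_ac)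
      also have "\<dots> \<le> ennreal (K * (\<theta>\<^sup>2 * h (\<theta> / s)) * nd (q * \<theta>) x)"
        by (intro ennreal_leI main)
      finally show "ennreal (nd (q * f) x) * (ennreal (coord_weight h s q n x \<theta> / ?W) * ennreal (\<theta>\<^sup>2)) \<le>
          ennreal (K * (\<theta>\<^sup>2 * h (\<theta> / s)) * nd (q * \<theta>) x)" .
    qed
    finally show ?thesis using True by simp
  qed simp
  have "(\<integral>\<^sup>+x. ?I x * R 0 x \<partial>?N) \<le>
      (\<integral>\<^sup>+x. (\<integral>\<^sup>+\<theta>. ennreal (K * (\<theta>\<^sup>2 * h (\<theta> / s)) * nd (q * \<theta>) x) \<partial>lborel) \<partial>lborel)"
    by (subst nn_integral_density) (auto intro!: nn_integral_mono pw)
  also have "\<dots> = (\<integral>\<^sup>+\<theta>. (\<integral>\<^sup>+x. ennreal (K * (\<theta>\<^sup>2 * h (\<theta> / s)) * nd (q * \<theta>) x) \<partial>lborel) \<partial>lborel)"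
    by (intro lborel_pair.Fubini') measurable
  also have "\<dots> = (\<integral>\<^sup>+\<theta>. ennreal (K * (\<theta>\<^sup>2 * h (\<theta> / s))) \<partial>lborel)"
    using K nd0 less_imp_le[OF h_pos]
    by (intro nn_integral_cong) (simp add: ennreal_mult nn_integral_cmult nd1)
  also have "\<dots> = ennreal s * (\<integral>\<^sup>+u. ennreal (K * s\<^sup>2 * (u\<^sup>2 * h u)) \<partial>lborel)"
    using s by (subst nn_integral_real_affine[where c = s and t = 0])
      (auto simp: power_mult_distrib mult_ac)
  also have "\<dots> = ennreal s * ennreal (K * s\<^sup>2 * M)"
    using K less_imp_le[OF h_pos] unfolding M_def
    by (subst nn_integral_eq_integral) (auto intro!: integrable_mult_right h_sq)
  also have "\<dots> = ennreal (exp (1 + C\<^sup>2 / 2) / h 1 * M * s\<^sup>2 / 2)"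
    using s K h_pos[of 1] by (simp add: ennreal_mult'[symmetric] K_def power2_eq_square field_simps)
  finally have m2: "(\<integral>\<^sup>+x. ?I x * R 0 x \<partial>?N) \<le>
      ennreal (exp (1 + C\<^sup>2 / 2) / h 1 * M * s\<^sup>2 / 2)" .
  have M0: "0 \<le> exp (1 + C\<^sup>2 / 2) / h 1 * M * s\<^sup>2"
    using less_imp_le[OF h_pos] by (auto simp: M_def intro!: mult_nonneg_nonneg divide_nonneg_nonneg integral_nonneg_AE)
  \<comment> \<open>Splitting at 0 reflects shrinkage: an undetectable signal is in effect estimated
    by 0, at the price \<open>2 * f\<^sup>2\<close>. The factor 2 on the second moment absorbs the
    \<open>/ 2\<close> in \<open>m2\<close>.\<close>
  have "(\<integral>\<^sup>+x. ?I x * R f x \<partial>?N) \<le>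
      (\<integral>\<^sup>+x. 2 * (?I x * R 0 x) + ennreal (2 * f\<^sup>2) \<partial>?N)"
    using posterior_risk_shift[OF s q n, where f = f and y = 0, folded R_def]
    by (intro nn_integral_mono) (auto simp: indicator_def)
  also have "\<dots> = 2 * (\<integral>\<^sup>+x. ?I x * R 0 x \<partial>?N) + ennreal (2 * f\<^sup>2)"
    by (subst nn_integral_add) (auto simp: nn_integral_cmult N.emeasure_space_1[simplified])
  also have "\<dots> \<le> 2 * ennreal (exp (1 + C\<^sup>2 / 2) / h 1 * M * s\<^sup>2 / 2) + ennreal (2 * f\<^sup>2)"
    by (intro add_right_mono mult_left_mono m2) simp
  also have "\<dots> = ennreal (exp (1 + C\<^sup>2 / 2) / h 1 * M * s\<^sup>2 + 2 * f\<^sup>2)"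
    using M0 by (subst ennreal_plus) (auto simp: ennreal_mult'[symmetric] ennreal_numeral[symmetric] simp del: ennreal_numeral)
  finally show ?thesis unfolding nd_def M_def R_def .
qed

end

text \<open>Markov's inequality for \<open>exp \<bar>z\<bar>\<close>. The mean shifts the
  standardised variable by at most 1, which accounts for a factor \<open>exp 1\<close>; the rest of
  the constant is \<open>std_normal_exp_abs_le\<close>. An exponential tail is enough because
  \<open>T\<close> will be logarithmic in the frequency.\<close>

lemma normal_tail_le:
  assumes \<sigma>: "0 < \<sigma>" and \<mu>: "\<bar>\<mu>\<bar> \<le> \<sigma>"
  shows "(\<integral>\<^sup>+x. indicator {x. \<not> \<bar>x / \<sigma>\<bar> \<le> T} x \<partial>density lborel (\<lambda>x. ennreal (normal_density \<mu> \<sigma> x)))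
    \<le> ennreal (2 * exp (3 / 2) * exp (- T))"
proof -
  let ?N = "density lborel (\<lambda>x. ennreal (std_normal_density x))"
  have "(\<integral>\<^sup>+x. indicator {x. \<not> \<bar>x / \<sigma>\<bar> \<le> T} x \<partial>density lborel (\<lambda>x. ennreal (normal_density \<mu> \<sigma> x))) =
      (\<integral>\<^sup>+z. indicator {x. \<not> \<bar>x / \<sigma>\<bar> \<le> T} (\<mu> + \<sigma> * z) \<partial>?N)"
    using \<sigma> by (intro nn_integral_normal_affine) auto
  also have "\<dots> \<le> (\<integral>\<^sup>+z. ennreal (exp (1 - T)) * ennreal (exp \<bar>z\<bar>) \<partial>?N)"
  proof (rule nn_integral_mono)
    fix z
    have "(\<mu> + \<sigma> * z) / \<sigma> = \<mu> / \<sigma> + z" using \<sigma> by (simp add: field_simps)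
    moreover have "\<bar>\<mu> / \<sigma>\<bar> \<le> 1" using \<sigma> \<mu> by simp
    ultimately have "T - 1 \<le> \<bar>z\<bar>" if "\<not> \<bar>(\<mu> + \<sigma> * z) / \<sigma>\<bar> \<le> T" using that by linarith
    then show "indicator {x. \<not> \<bar>x / \<sigma>\<bar> \<le> T} (\<mu> + \<sigma> * z) \<le> ennreal (exp (1 - T)) * ennreal (exp \<bar>z\<bar>)"
      by (auto simp: indicator_def ennreal_mult[symmetric] exp_add[symmetric] simp del: ennreal_1 simp flip: ennreal_1 intro!: ennreal_leI)
  qed
  also have "\<dots> \<le> ennreal (exp (1 - T)) * ennreal (2 * exp (1 / 2))"
    by (subst nn_integral_cmult) (auto intro!: mult_left_mono std_normal_exp_abs_le)
  also have "\<dots> = ennreal (2 * (exp (1 / 2) * exp 1) * exp (- T))"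
    by (simp add: ennreal_mult[symmetric] exp_diff exp_minus field_simps)
  finally show ?thesis by (simp flip: exp_add)
qed

section \<open>Reduction to coordinates\<close>

lemma bij_betw_Suc_atLeast: "bij_betw Suc UNIV {1..}"
  by (intro bij_betw_imageI) (auto simp: image_iff Suc_le_eq gr0_conv_Suc)

lemma has_sum_atLeast_Suc:
  fixes a :: "nat \<Rightarrow> real"
  assumes "(\<lambda>i. a (Suc i)) sums S" and "\<And>i. 0 \<le> a (Suc i)"
  shows "(a has_sum S) {1..}"
proof -
  have "((\<lambda>i. a (Suc i)) has_sum S) UNIV"
    using assms by (rule sums_nonneg_imp_has_sum)
  then show ?thesis
    by (subst (asm) has_sum_reindex_bij_betw[OF bij_betw_Suc_atLeast])
qed

lemma sums_Suc_of_summable_on: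
  fixes a :: "nat \<Rightarrow> real"
  assumes "a summable_on {1..}"
  shows "(\<lambda>i. a (Suc i)) sums (\<Sum>\<^sub>\<infinity>k\<in>{1..}. a k)"
proof -
  have "((\<lambda>i. a (Suc i)) has_sum (\<Sum>\<^sub>\<infinity>k\<in>{1..}. a k)) UNIV"
    using has_sum_infsum[OF assms] by (subst has_sum_reindex_bij_betw[OF bij_betw_Suc_atLeast])
  then show ?thesis by (rule has_sum_imp_sums)
qed

text \<open>A divergent series of squares has the value \<open>top\<close> in
  \<open>ennreal\<close>, so infinite norm is covered as well: if the claim fails, the series is
  finite, and the norm is then its ordinary square root.\<close>

lemma l2norm_gt_imp:
  assumes "ereal \<epsilon> < l2norm g" and "0 < \<epsilon>"
  shows "ennreal (\<epsilon>\<^sup>2) \<le> (\<Sum>i. ennreal ((g (Suc i))\<^sup>2))"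
proof (rule ccontr)
  assume "\<not> ?thesis"
  then have lt: "(\<Sum>i. ennreal ((g (Suc i))\<^sup>2)) < ennreal (\<epsilon>\<^sup>2)" by simp
  then have fin: "(\<Sum>i. ennreal ((g (Suc i))\<^sup>2)) \<noteq> top" by auto
  then have sm: "summable (\<lambda>i. (g (Suc i))\<^sup>2)"
    by (intro summable_suminf_not_top) auto
  then have hs: "((\<lambda>k. (g k)\<^sup>2) has_sum (\<Sum>i. (g (Suc i))\<^sup>2)) {1..}"
    by (intro has_sum_atLeast_Suc summable_sums) auto
  have "(\<Sum>i. (g (Suc i))\<^sup>2) < \<epsilon>\<^sup>2"
    using lt fin sm by (subst (asm) suminf_ennreal2) (auto simp: ennreal_less_iff suminf_nonneg)
  then have "sqrt (\<Sum>i. (g (Suc i))\<^sup>2) < \<epsilon>"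
    using assms(2) real_less_lsqrt[of \<epsilon>] by (simp add: real_sqrt_less_iff flip: real_sqrt_abs)
  moreover have "l2norm g = ereal (sqrt (\<Sum>i. (g (Suc i))\<^sup>2))"
    by (simp only: l2norm_def has_sum_imp_summable[OF hs] infsumI[OF hs] if_True)
  ultimately show False
    using assms(1) by simp
qed

lemma prob_space_obs_coord:
  assumes "0 < n"
  shows "prob_space (density lborel (\<lambda>x. ennreal (normal_density \<mu> (1 / sqrt (real n)) x)))"
  using assms by (intro prob_space_normal_density) simp

lemma nn_integral_PiM_component:
  assumes "\<And>i. i \<in> I \<Longrightarrow> prob_space (M i)" and "i \<in> I" and "f \<in> borel_measurable (M i)"
  shows "(\<integral>\<^sup>+\<omega>. f (\<omega> i) \<partial>PiM I M) = (\<integral>\<^sup>+x. f x \<partial>M i)"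
proof -
  have "(\<integral>\<^sup>+x. f x \<partial>M i) = (\<integral>\<^sup>+x. f x \<partial>distr (PiM I M) (M i) (\<lambda>\<omega>. \<omega> i))"
    using assms by (simp add: distr_PiM_component)
  also have "\<dots> = (\<integral>\<^sup>+\<omega>. f (\<omega> i) \<partial>PiM I M)"
    using assms by (intro nn_integral_distr) (auto intro: measurable_component_singleton)
  finally show ?thesis ..
qed

context tail_density
begin

lemma posterior_tail_le:
  assumes n: "0 < n" and \<sigma>: "\<And>k. 1 \<le> k \<Longrightarrow> 0 < \<sigma> k" and \<kappa>: "\<And>k. 1 \<le> k \<Longrightarrow> 0 < \<kappa> k" and \<epsilon>: "0 < \<epsilon>"
  shows "emeasure (posterior h \<sigma> \<kappa> n X) {f \<in> space (posterior h \<sigma> \<kappa> n X). ereal \<epsilon> < l2norm (\<lambda>k. f k - f0 k)}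
    \<le> (\<Sum>i. ennreal (1 / \<epsilon>\<^sup>2) *
        (\<integral>\<^sup>+\<theta>. ennreal ((\<theta> - f0 (Suc i))\<^sup>2) \<partial>coord_posterior h (\<sigma> (Suc i)) (\<kappa> (Suc i)) n (X (Suc i))))"
proof -
  let ?P = "posterior h \<sigma> \<kappa> n X"
  define M where "M k = coord_posterior h (\<sigma> k) (\<kappa> k) n (X k)" for k
  have P: "?P = PiM {1..} M" by (simp add: posterior_def M_def[abs_def])
  have M: "prob_space (M k)" if "k \<in> {1..}" for k
    unfolding M_def using that n \<sigma> \<kappa> by (intro prob_space_coord_posterior) auto
  have sets_M [measurable_cong]: "sets (M k) = sets borel" for k
    by (simp add: M_def coord_posterior_def)
  have sq_meas: "(\<lambda>\<theta>. ennreal ((\<theta> - a)\<^sup>2)) \<in> borel_measurable (M k)" for a :: real and k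
    by measurable
  have comp [measurable]: "(\<lambda>f. f (Suc i)) \<in> borel_measurable ?P" for i
    using measurable_component_singleton[of "Suc i" "{1..}" M] unfolding P
    by (simp add: measurable_cong_sets[OF refl sets_M])
  define u where "u f = (\<Sum>i. ennreal ((f (Suc i) - f0 (Suc i))\<^sup>2))" for f :: "nat \<Rightarrow> real"
  have [measurable]: "u \<in> borel_measurable ?P"
    unfolding u_def by measurable
  have imp: "1 \<le> ennreal (1 / \<epsilon>\<^sup>2) * u f" if "ereal \<epsilon> < l2norm (\<lambda>k. f k - f0 k)" for f
  proof -
    have "ennreal (1 / \<epsilon>\<^sup>2) * ennreal (\<epsilon>\<^sup>2) \<le> ennreal (1 / \<epsilon>\<^sup>2) * u f"
      using l2norm_gt_imp[OF that \<epsilon>] by (intro mult_left_mono) (auto simp: u_def)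
    then show ?thesis using \<epsilon> by (simp add: ennreal_mult[symmetric])
  qed
  \<comment> \<open>The event is enclosed in one described by the measurable function
    \<open>u\<close>, to which Markov's inequality applies.\<close>
  have "emeasure ?P {f \<in> space ?P. ereal \<epsilon> < l2norm (\<lambda>k. f k - f0 k)} \<le>
      emeasure ?P {f \<in> space ?P. 1 \<le> ennreal (1 / \<epsilon>\<^sup>2) * u f}"
    using imp by (intro emeasure_mono) auto
  also have "\<dots> \<le> ennreal (1 / \<epsilon>\<^sup>2) * (\<integral>\<^sup>+f. u f * indicator (space ?P) f \<partial>?P)"
    by (intro nn_integral_Markov_inequality) auto
  also have "(\<integral>\<^sup>+f. u f * indicator (space ?P) f \<partial>?P) = (\<integral>\<^sup>+f. u f \<partial>?P)"
    by (intro nn_integral_cong) simp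
  also have "\<dots> = (\<Sum>i. \<integral>\<^sup>+f. ennreal ((f (Suc i) - f0 (Suc i))\<^sup>2) \<partial>?P)"
    unfolding u_def by (intro nn_integral_suminf) measurable
  also have "\<dots> = (\<Sum>i. \<integral>\<^sup>+\<theta>. ennreal ((\<theta> - f0 (Suc i))\<^sup>2) \<partial>M (Suc i))"
    unfolding P by (intro suminf_cong nn_integral_PiM_component M sq_meas) auto
  finally show ?thesis
    by (simp add: M_def)
qed

text \<open>
  Off the sets \<open>A k\<close> the posterior probability is bounded by \<open>1\<close>; this truncation keeps
  the expected posterior risk finite where the observation is atypically large.
\<close>

lemma expected_posterior_tail_le:
  fixes A :: "nat \<Rightarrow> real set" and f0 :: "nat \<Rightarrow> real"
  assumes n: "0 < n" and \<sigma>: "\<And>k. 1 \<le> k \<Longrightarrow> 0 < \<sigma> k" and \<kappa>: "\<And>k. 1 \<le> k \<Longrightarrow> 0 < \<kappa> k" and \<epsilon>: "0 < \<epsilon>"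
    and A: "\<And>k. A k \<in> sets borel"
  defines "N \<equiv> \<lambda>k. density lborel (\<lambda>x. ennreal (normal_density (\<kappa> k * f0 k) (1 / sqrt (real n)) x))"
  shows "(\<integral>\<^sup>+X. emeasure (posterior h \<sigma> \<kappa> n X)
        {f \<in> space (posterior h \<sigma> \<kappa> n X). ereal \<epsilon> < l2norm (\<lambda>k. f k - f0 k)} \<partial>obs_law \<kappa> f0 n)
    \<le> (\<Sum>i. (\<integral>\<^sup>+x. indicator (- A (Suc i)) x \<partial>N (Suc i)) +
        ennreal (1 / \<epsilon>\<^sup>2) * (\<integral>\<^sup>+x. indicator (A (Suc i)) x *
          (\<integral>\<^sup>+\<theta>. ennreal ((\<theta> - f0 (Suc i))\<^sup>2) \<partial>coord_posterior h (\<sigma> (Suc i)) (\<kappa> (Suc i)) n x) \<partial>N (Suc i)))"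
proof -
  note A [measurable]
  define R where "R k x = (\<integral>\<^sup>+\<theta>. ennreal ((\<theta> - f0 k)\<^sup>2) \<partial>coord_posterior h (\<sigma> k) (\<kappa> k) n x)" for k x
  have [measurable]: "R (Suc i) \<in> borel_measurable borel" for i
    unfolding R_def using n \<sigma> \<kappa> by (intro posterior_risk_measurable) auto
  \<comment> \<open>Union bound and Markov bound in a single function. The sum of the
    \<open>g k\<close> dominates the posterior mass at every \<open>X\<close>, so that mass enters
    only through monotonicity of the integral.\<close>
  define g where "g k x = indicator (- A k) x + ennreal (1 / \<epsilon>\<^sup>2) * (indicator (A k) x * R k x)" for k x
  have [measurable]: "g (Suc i) \<in> borel_measurable borel" for i
    unfolding g_def by measurable
  have obs: "obs_law \<kappa> f0 n = PiM {1..} N"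
    by (simp add: obs_law_def N_def)
  have N: "prob_space (N k)" for k
    unfolding N_def by (rule prob_space_obs_coord[OF n])
  have sets_N [measurable_cong]: "sets (N k) = sets borel" for k
    by (simp add: N_def)
  have g_meas: "g (Suc i) \<in> borel_measurable (N (Suc i))" for i
    by measurable
  have comp: "(\<lambda>X. X (Suc i)) \<in> borel_measurable (PiM {1..} N)" for i
    using measurable_component_singleton[of "Suc i" "{1..}" N]
    by (simp add: measurable_cong_sets[OF refl sets_N])
  have pw: "emeasure (posterior h \<sigma> \<kappa> n X)
        {f \<in> space (posterior h \<sigma> \<kappa> n X). ereal \<epsilon> < l2norm (\<lambda>k. f k - f0 k)} \<le> (\<Sum>i. g (Suc i) (X (Suc i)))"
    (is "?L \<le> _") for X
  proof (cases "\<forall>i. X (Suc i) \<in> A (Suc i)")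
    case True
    then have eq: "(\<Sum>i. g (Suc i) (X (Suc i))) = (\<Sum>i. ennreal (1 / \<epsilon>\<^sup>2) * R (Suc i) (X (Suc i)))"
      by (simp add: g_def)
    show ?thesis
      unfolding eq R_def by (rule posterior_tail_le[OF n \<sigma> \<kappa> \<epsilon>])
  next
    case False
    then obtain i where i: "X (Suc i) \<notin> A (Suc i)" by auto
    have "prob_space (posterior h \<sigma> \<kappa> n X)"
      unfolding posterior_def using n \<sigma> \<kappa> by (intro prob_space_PiM prob_space_coord_posterior) auto
    then have "?L \<le> 1" by (rule prob_space.measure_le_1)
    also have "1 = (\<Sum>i\<in>{i}. g (Suc i) (X (Suc i)))" using i by (simp add: g_def)
    also have "\<dots> \<le> (\<Sum>i. g (Suc i) (X (Suc i)))" by (rule sum_le_suminf) auto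
    finally show ?thesis by simp
  qed
  have "(\<integral>\<^sup>+X. emeasure (posterior h \<sigma> \<kappa> n X)
        {f \<in> space (posterior h \<sigma> \<kappa> n X). ereal \<epsilon> < l2norm (\<lambda>k. f k - f0 k)} \<partial>obs_law \<kappa> f0 n) \<le>
      (\<integral>\<^sup>+X. (\<Sum>i. g (Suc i) (X (Suc i))) \<partial>PiM {1..} N)"
    unfolding obs by (intro nn_integral_mono pw)
  also have "\<dots> = (\<Sum>i. \<integral>\<^sup>+X. g (Suc i) (X (Suc i)) \<partial>PiM {1..} N)"
    by (intro nn_integral_suminf measurable_compose[OF comp]) simp
  also have "\<dots> = (\<Sum>i. \<integral>\<^sup>+x. g (Suc i) x \<partial>N (Suc i))"
    by (intro suminf_cong nn_integral_PiM_component N g_meas) auto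
  also have "\<dots> = (\<Sum>i. (\<integral>\<^sup>+x. indicator (- A (Suc i)) x \<partial>N (Suc i)) +
      ennreal (1 / \<epsilon>\<^sup>2) * (\<integral>\<^sup>+x. indicator (A (Suc i)) x * R (Suc i) x \<partial>N (Suc i)))"
  proof (rule suminf_cong)
    fix i
    show "(\<integral>\<^sup>+x. g (Suc i) x \<partial>N (Suc i)) = (\<integral>\<^sup>+x. indicator (- A (Suc i)) x \<partial>N (Suc i)) +
        ennreal (1 / \<epsilon>\<^sup>2) * (\<integral>\<^sup>+x. indicator (A (Suc i)) x * R (Suc i) x \<partial>N (Suc i))"
    proof -
      have "(indicator (- A (Suc i)) :: real \<Rightarrow> ennreal) \<in> borel_measurable (N (Suc i))"
        "(\<lambda>x. indicator (A (Suc i)) x * R (Suc i) x) \<in> borel_measurable (N (Suc i))"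
        by measurable
      then show ?thesis
        unfolding g_def by (simp add: nn_integral_add nn_integral_cmult)
    qed
  qed
  finally show ?thesis unfolding R_def .
qed

end

section \<open>Rates\<close>

text \<open>By telescoping: \<open>1 / (1 + ln k)\<close> tends to 0, and its decrease from one
  integer to the next dominates the term at the larger one, because
  \<open>ln (k + 1) - ln k \<ge> 1 / (k + 1)\<close>.\<close>

lemma summable_log_sq:
  "summable (\<lambda>i. 1 / (real (Suc i) * (1 + ln (real (Suc i)))\<^sup>2))"
proof -
  define g where "g i = 1 / (1 + ln (real (Suc i)))" for i
  have "filterlim (\<lambda>i. 1 + ln (real (Suc i))) at_top sequentially"
    by (intro filterlim_tendsto_add_at_top[OF tendsto_const] filterlim_compose[OF ln_at_top]
        filterlim_compose[OF filterlim_real_sequentially filterlim_Suc])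
  then have "g \<longlonglongrightarrow> 0"
    unfolding g_def by (intro tendsto_divide_0[OF tendsto_const] filterlim_at_top_imp_at_infinity)
  then have sm: "summable (\<lambda>i. g i - g (Suc i))" by (rule telescope_summable')
  have "summable (\<lambda>i. 1 / (real (Suc (Suc i)) * (1 + ln (real (Suc (Suc i))))\<^sup>2))"
  proof (rule summable_comparison_test'[OF sm])
    fix i :: nat
    define a where "a = 1 + ln (real (Suc i))"
    define b where "b = 1 + ln (real (Suc (Suc i)))"
    have a: "1 \<le> a" and ab: "a \<le> b" by (auto simp: a_def b_def)
    have "1 / real (Suc (Suc i)) \<le> b - a"
    proof -
      have "ln (real (Suc i) / real (Suc (Suc i))) \<le> real (Suc i) / real (Suc (Suc i)) - 1"
        by (rule ln_le_minus_one) simp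
      also have "\<dots> = - (1 / real (Suc (Suc i)))" by (simp add: field_simps)
      finally show ?thesis by (simp add: a_def b_def ln_div)
    qed
    then have "1 / real (Suc (Suc i)) * (1 / b\<^sup>2) \<le> (b - a) * (1 / (a * b))"
      using a ab by (intro mult_mono) (auto simp: power2_eq_square intro!: divide_left_mono mult_right_mono mult_pos_pos)
    also have "\<dots> = g i - g (Suc i)"
    proof -
      have "g i = 1 / a" "g (Suc i) = 1 / b" by (simp_all only: g_def a_def b_def)
      then show ?thesis using a ab by (simp add: field_simps)
    qed
    finally show "norm (1 / (real (Suc (Suc i)) * (1 + ln (real (Suc (Suc i))))\<^sup>2)) \<le> g i - g (Suc i)"
      by (simp add: b_def)
  qed
  then show ?thesis by (subst (asm) summable_Suc_iff)
qed

text \<open>Writing \<open>k = r K\<close>, submultiplicativity of \<open>1 + ln\<close> leaves \<open>r powr (- b) * (1 + ln r) ^ P\<close>, which is bounded.\<close>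

lemma powr_polylog_decay:
  fixes b :: real
  assumes b: "0 < b" and P: "0 < P"
  shows "\<exists>G\<ge>0. \<forall>K\<ge>1. \<forall>k\<ge>K. k powr (- b) * (1 + ln k) ^ P \<le> G * (K powr (- b) * (1 + ln K) ^ P)"
proof (intro exI conjI allI impI)
  \<comment> \<open>With this choice the \<open>P\<close>-th power of
    \<open>exp (\<delta> * (1 + ln r))\<close> is \<open>exp b * r powr b\<close>, which the decay
    cancels.\<close>
  define \<delta> where "\<delta> = b / real P"
  have \<delta>: "0 < \<delta>" "real P * \<delta> = b" using b P by (auto simp: \<delta>_def)
  show "0 \<le> exp b / \<delta> ^ P" using \<delta> by simp
  fix K k :: real
  assume K: "1 \<le> K" and k: "K \<le> k"
  define r where "r = k / K"
  have r: "1 \<le> r" "k = r * K" using K k by (auto simp: r_def)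
  have "1 + ln k \<le> (1 + ln K) * (1 + ln r)"
    using r K by (simp add: ln_mult algebra_simps)
  then have "(1 + ln k) ^ P \<le> ((1 + ln K) * (1 + ln r)) ^ P"
    using K k by (intro power_mono) auto
  then have 1: "(1 + ln k) ^ P \<le> (1 + ln K) ^ P * (1 + ln r) ^ P"
    by (simp add: power_mult_distrib)
  have "\<delta> * (1 + ln r) \<le> exp (\<delta> * (1 + ln r))"
    using exp_ge_add_one_self[of "\<delta> * (1 + ln r)"] by linarith
  then have "(\<delta> * (1 + ln r)) ^ P \<le> exp (\<delta> * (1 + ln r)) ^ P"
    using \<delta> r by (intro power_mono) auto
  also have "\<dots> = exp b * r powr b"
    using r \<delta>(2) by (simp add: powr_def exp_add[symmetric] exp_of_nat_mult[symmetric] algebra_simps)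
  finally have "\<delta> ^ P * (1 + ln r) ^ P \<le> exp b * r powr b"
    by (simp only: power_mult_distrib)
  then have "(1 + ln r) ^ P \<le> exp b / \<delta> ^ P * r powr b"
    using \<delta> by (simp add: field_simps)
  then have 2: "r powr (- b) * (1 + ln r) ^ P \<le> exp b / \<delta> ^ P"
    using r by (simp add: powr_minus field_simps)
  have "k powr (- b) * (1 + ln k) ^ P \<le> (r powr (- b) * K powr (- b)) * ((1 + ln K) ^ P * (1 + ln r) ^ P)"
    using r K 1 by (auto simp: powr_mult intro!: mult_left_mono)
  also have "\<dots> = (r powr (- b) * (1 + ln r) ^ P) * (K powr (- b) * (1 + ln K) ^ P)"
    by (simp only: mult_ac)
  also have "\<dots> \<le> exp b / \<delta> ^ P * (K powr (- b) * (1 + ln K) ^ P)"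
    using 2 K by (intro mult_right_mono) auto
  finally show "k powr (- b) * (1 + ln k) ^ P \<le> exp b / \<delta> ^ P * (K powr (- b) * (1 + ln K) ^ P)" .
qed

text \<open>Both families of prior scales enter only through \<open>\<sigma>_le\<close> and
  \<open>\<sigma>_ge\<close>: small enough to regularise at smoothness \<beta>, but not so small
  that \<open>ln (1 / \<sigma> k)\<close> exceeds a power of \<open>1 + ln k\<close>. The number
  \<open>L\<close> serves as a bound of the single coefficients.\<close>

locale inverse_regression = tail_density h B c m for h B c m +
  fixes \<kappa> f0 \<sigma> :: "nat \<Rightarrow> real" and \<nu> \<beta> c0 C0 L S D :: real
  assumes \<nu>: "0 \<le> \<nu>" and \<beta>: "0 < \<beta>" and c0: "0 < c0" and C0: "0 < C0"
    and \<kappa>_lower: "1 \<le> k \<Longrightarrow> c0 * real k powr (- \<nu>) \<le> \<kappa> k"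
    and \<kappa>_upper: "1 \<le> k \<Longrightarrow> \<kappa> k \<le> C0 * real k powr (- \<nu>)"
    and f0_summable: "summable (\<lambda>i. real (Suc i) powr (2 * \<beta>) * (f0 (Suc i))\<^sup>2)"
    and L: "0 \<le> L" and f0_le: "1 \<le> k \<Longrightarrow> \<bar>f0 k\<bar> \<le> L"
    and \<sigma>_pos: "1 \<le> k \<Longrightarrow> 0 < \<sigma> k"
    and S: "0 < S" and \<sigma>_le: "1 \<le> k \<Longrightarrow> \<sigma> k \<le> S * real k powr (- 1 / 2 - \<beta>)"
    and D: "0 \<le> D" and \<sigma>_ge: "1 \<le> k \<Longrightarrow> 1 / \<sigma> k \<le> exp (D * (1 + ln (real k))\<^sup>2)"
begin

abbreviation law where
  "law n k \<equiv> density lborel (\<lambda>x. ennreal (normal_density (\<kappa> k * f0 k) (1 / sqrt (real n)) x))"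

abbreviation risk where
  "risk n k x \<equiv> \<integral>\<^sup>+\<theta>. ennreal ((\<theta> - f0 k)\<^sup>2) \<partial>coord_posterior h (\<sigma> k) (\<kappa> k) n x"

section \<open>Noise level and logarithmic factors in terms of the frequency\<close>

lemma \<kappa>_pos: "1 \<le> k \<Longrightarrow> 0 < \<kappa> k"
  using \<kappa>_lower[of k] c0 by (smt (verit) mult_pos_pos of_nat_0_less_iff powr_gt_zero zero_less_one_class.zero_less_one less_le_trans)

lemma noise_le:
  assumes k: "1 \<le> k" and n: "1 \<le> n"
  shows "(1 / (sqrt (real n) * \<kappa> k))\<^sup>2 \<le> real k powr (2 * \<nu>) / (c0\<^sup>2 * real n)"
proof -
  have "1 / \<kappa> k \<le> real k powr \<nu> / c0"
    using \<kappa>_lower[OF k] \<kappa>_pos[OF k] c0 k by (simp add: powr_minus field_simps)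
  then have "(1 / \<kappa> k)\<^sup>2 \<le> (real k powr \<nu> / c0)\<^sup>2"
    using \<kappa>_pos[OF k] by (intro power_mono) auto
  also have "\<dots> = real k powr (2 * \<nu>) / c0\<^sup>2"
    using k by (simp add: power_divide powr_power mult.commute)
  finally have "(1 / \<kappa> k)\<^sup>2 / real n \<le> real k powr (2 * \<nu>) / c0\<^sup>2 / real n"
    by (rule divide_right_mono) simp
  then show ?thesis
    using n by (simp add: power_mult_distrib power_divide mult.commute)
qed

text \<open>Uniform in \<open>n\<close>, since \<tau> is at most \<open>k powr \<nu> / c0\<close>
  for all \<open>n \<ge> 1\<close>. Signal, noise level and inverse prior scale are then all bounded
  by exponentials, and \<open>(1 + ln k)\<^sup>2\<close> dominates their exponents. Its
  \<open>m\<close>-th power causes the exponent \<open>2 * m\<close> below.\<close>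

lemma log_ratio_le:
  assumes k: "1 \<le> k" and n: "1 \<le> n"
  shows "ln (1 + (\<bar>f0 k\<bar> + 1 / (sqrt (real n) * \<kappa> k)) / \<sigma> k) \<le> (ln (1 + L + 1 / c0) + \<nu> + D) * (1 + ln (real k))\<^sup>2"
proof -
  define l where "l = ln (real k)"
  define w where "w = (1 + l)\<^sup>2"
  have l: "0 \<le> l" using k by (simp add: l_def)
  have w: "1 \<le> w" "l \<le> w" using l by (auto simp: w_def power2_eq_square algebra_simps)
  define M where "M = ln (1 + L + 1 / c0)"
  have pos: "0 < 1 + L + 1 / c0" using L c0 divide_pos_pos[of 1 c0] by linarith
  have M: "0 \<le> M" using L c0 by (simp add: M_def)
  have "1 / (sqrt (real n) * \<kappa> k) \<le> 1 / (1 * (c0 * real k powr (- \<nu>)))"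
    using n k c0 \<kappa>_lower[OF k] by (intro divide_left_mono mult_mono mult_pos_pos) (auto simp: \<kappa>_pos)
  also have "\<dots> = 1 / c0 * exp (\<nu> * l)"
    using k c0 by (simp add: powr_def l_def exp_minus field_simps)
  finally have t: "1 / (sqrt (real n) * \<kappa> k) \<le> 1 / c0 * exp (\<nu> * l)" .
  have e1: "1 \<le> exp (\<nu> * l)" using \<nu> l by simp
  have "\<bar>f0 k\<bar> + 1 / (sqrt (real n) * \<kappa> k) \<le> L * exp (\<nu> * l) + 1 / c0 * exp (\<nu> * l)"
    using t f0_le[OF k] mult_left_mono[OF e1 L] by linarith
  then have "(\<bar>f0 k\<bar> + 1 / (sqrt (real n) * \<kappa> k)) * (1 / \<sigma> k) \<le> (L * exp (\<nu> * l) + 1 / c0 * exp (\<nu> * l)) * exp (D * w)"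
    using \<sigma>_ge[OF k] \<sigma>_pos[OF k] L c0 \<kappa>_pos[OF k] by (intro mult_mono) (auto simp: w_def l_def)
  moreover have "1 \<le> exp (\<nu> * l) * exp (D * w)"
    using \<nu> l D w by (simp flip: exp_add)
  ultimately have "1 + (\<bar>f0 k\<bar> + 1 / (sqrt (real n) * \<kappa> k)) / \<sigma> k \<le> (1 + L + 1 / c0) * (exp (\<nu> * l) * exp (D * w))"
    by (simp add: algebra_simps add_divide_distrib)
  also have "\<dots> = exp (M + (\<nu> * l + D * w))"
    using pos by (simp add: M_def exp_add)
  also have "\<dots> \<le> exp ((M + \<nu> + D) * w)"
    using mult_left_mono[OF w(1) M] mult_left_mono[OF w(2) \<nu>] by (simp add: algebra_simps)
  finally have "1 + (\<bar>f0 k\<bar> + 1 / (sqrt (real n) * \<kappa> k)) / \<sigma> k \<le> exp ((M + \<nu> + D) * w)" .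
  moreover have "0 < 1 + (\<bar>f0 k\<bar> + 1 / (sqrt (real n) * \<kappa> k)) / \<sigma> k"
    using \<sigma>_pos[OF k] \<kappa>_pos[OF k] n by (intro add_pos_nonneg divide_nonneg_pos add_nonneg_nonneg) auto
  ultimately show ?thesis
    by (metis M_def l_def w_def ln_exp ln_mono)
qed

lemma risk_polylog:
  "\<exists>C\<ge>0. \<forall>n\<ge>1. \<forall>k\<ge>1. (\<integral>\<^sup>+x. risk n k x \<partial>law n k) \<le>
    ennreal (C * (1 / (sqrt (real n) * \<kappa> k))\<^sup>2 * (1 + ln (real k)) ^ (2 * m))"
proof -
  obtain C where C: "0 \<le> C"
    and bd: "\<And>s q n f. 0 < s \<Longrightarrow> 0 < q \<Longrightarrow> 0 < n \<Longrightarrow>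
    (\<integral>\<^sup>+x. (\<integral>\<^sup>+\<theta>. ennreal ((\<theta> - f)\<^sup>2) \<partial>coord_posterior h s q n x)
      \<partial>density lborel (\<lambda>x. ennreal (normal_density (q * f) (1 / sqrt (real n)) x)))
    \<le> ennreal (C * (1 / (sqrt (real n) * q))\<^sup>2 * (1 + ln (1 + (\<bar>f\<bar> + 1 / (sqrt (real n) * q)) / s) ^ m))"
    using averaged_posterior_risk by blast
  define E where "E = ln (1 + L + 1 / c0) + \<nu> + D"
  have E: "0 \<le> E" using L c0 \<nu> D by (simp add: E_def)
  show ?thesis
  proof (intro exI[of _ "C * (1 + E ^ m)"] conjI allI impI)
    show "0 \<le> C * (1 + E ^ m)" using C E by simp
    fix n k :: nat assume n: "1 \<le> n" and k: "1 \<le> k"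
    define l where "l = ln (1 + (\<bar>f0 k\<bar> + 1 / (sqrt (real n) * \<kappa> k)) / \<sigma> k)"
    have l: "l \<le> E * (1 + ln (real k))\<^sup>2" unfolding l_def E_def by (rule log_ratio_le[OF k n])
    have "0 \<le> l" unfolding l_def using \<sigma>_pos[OF k] \<kappa>_pos[OF k] by simp
    then have "l ^ m \<le> (E * (1 + ln (real k))\<^sup>2) ^ m" by (intro power_mono l)
    then have "l ^ m \<le> E ^ m * (1 + ln (real k)) ^ (2 * m)"
      by (simp add: power_mult_distrib power_mult)
    moreover have "1 \<le> (1 + ln (real k)) ^ (2 * m)" using k by (intro one_le_power) simp
    ultimately have "1 + l ^ m \<le> (1 + E ^ m) * (1 + ln (real k)) ^ (2 * m)"
      by (simp add: algebra_simps)
    then have "C * (1 / (sqrt (real n) * \<kappa> k))\<^sup>2 * (1 + l ^ m) \<le>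
       C * (1 / (sqrt (real n) * \<kappa> k))\<^sup>2 * ((1 + E ^ m) * (1 + ln (real k)) ^ (2 * m))"
      using C by (intro mult_left_mono) auto
    then have le: "ennreal (C * (1 / (sqrt (real n) * \<kappa> k))\<^sup>2 * (1 + l ^ m)) \<le>
       ennreal (C * (1 + E ^ m) * (1 / (sqrt (real n) * \<kappa> k))\<^sup>2 * (1 + ln (real k)) ^ (2 * m))"
      by (intro ennreal_leI) (simp only: mult_ac)
    have "0 < n" using n by simp
    from order_trans[OF bd[OF \<sigma>_pos[OF k] \<kappa>_pos[OF k] this, of "f0 k", folded l_def] le]
    show "(\<integral>\<^sup>+x. risk n k x \<partial>law n k) \<le>
        ennreal (C * (1 + E ^ m) * (1 / (sqrt (real n) * \<kappa> k))\<^sup>2 * (1 + ln (real k)) ^ (2 * m))" .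
  qed
qed

text \<open>The balance point: at \<open>k = cutoff n\<close>, up to constants, the noise variance
  equals \<open>k powr (- 1 - 2 * \<beta>)\<close>. Hence the noise summed up to there matches the
  squared signal beyond, and the noise level overtakes
  \<open>k powr (- 1 / 2 - \<beta>)\<close>.\<close>

definition cutoff :: "nat \<Rightarrow> real" where
  "cutoff n = real n powr (1 / (2 * \<beta> + 2 * \<nu> + 1))"

text \<open>
  A summable majorant: up to \<open>k powr (- 2 * \<beta>)\<close> and powers of \<open>1 + ln k\<close> it dominates the squared
  signal and the squared prior scale, the latter being of order at most \<open>k powr (- 1 - 2 * \<beta>)\<close>.
\<close>

definition energy :: "nat \<Rightarrow> real" where
  "energy k = real k powr (2 * \<beta>) * (f0 k)\<^sup>2 + 1 / (real k * (1 + ln (real k))\<^sup>2)"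

section \<open>Noise, prior scale and signal on either side of the cutoff\<close>

lemma cutoff_ge_1: "1 \<le> n \<Longrightarrow> 1 \<le> cutoff n"
  using \<beta> \<nu> by (simp add: cutoff_def ge_one_powr_ge_zero)

lemma cutoff_powr: "cutoff n powr (2 * \<beta> + 2 * \<nu> + 1) = real n"
  using \<beta> \<nu> by (simp add: cutoff_def powr_powr)

lemma energy_nonneg: "0 \<le> energy k"
  by (cases "k = 0") (auto simp: energy_def intro!: add_nonneg_nonneg)

lemma low_frequency_le:
  assumes k: "1 \<le> k" "real k \<le> cutoff n" and n: "1 \<le> n"
  shows "(1 / (sqrt (real n) * \<kappa> k))\<^sup>2 \<le> cutoff n powr (- (2 * \<beta>)) * (1 / cutoff n) / c0\<^sup>2"
proof -
  have K: "1 \<le> cutoff n" by (rule cutoff_ge_1[OF n])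
  have "(1 / (sqrt (real n) * \<kappa> k))\<^sup>2 \<le> real k powr (2 * \<nu>) / (c0\<^sup>2 * real n)"
    by (rule noise_le[OF k(1) n])
  also have "\<dots> \<le> cutoff n powr (2 * \<nu>) / (c0\<^sup>2 * real n)"
    using k \<nu> by (intro divide_right_mono powr_mono2) auto
  also have "\<dots> = cutoff n powr (2 * \<nu>) / cutoff n powr (2 * \<beta> + 2 * \<nu> + 1) / c0\<^sup>2"
    by (simp add: cutoff_powr)
  also have "\<dots> = cutoff n powr (- (2 * \<beta>)) * (1 / cutoff n) / c0\<^sup>2"
    using K by (simp add: powr_add powr_minus field_simps)
  finally show ?thesis .
qed

lemma high_frequency_scale_le:
  assumes k: "1 \<le> k" "cutoff n \<le> real k" and n: "1 \<le> n"
  shows "\<sigma> k \<le> S * C0 * (1 / (sqrt (real n) * \<kappa> k))"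
proof -
  have "real n \<le> real k powr (2 * \<beta> + 2 * \<nu> + 1)"
    using cutoff_powr[of n] k \<beta> \<nu> cutoff_ge_1[OF n] powr_mono2[of "2 * \<beta> + 2 * \<nu> + 1" "cutoff n" "real k"] by auto
  then have "sqrt (real n) \<le> sqrt (real k powr (2 * \<beta> + 2 * \<nu> + 1))" by simp
  also have "\<dots> = real k powr (\<beta> + \<nu> + 1 / 2)"
    using k by (simp add: powr_half_sqrt[symmetric] powr_powr field_simps)
  finally have sn: "sqrt (real n) \<le> real k powr (\<beta> + \<nu> + 1 / 2)" .
  have "real k powr (- 1 / 2 - \<beta>) * (sqrt (real n) * \<kappa> k) \<le>
      real k powr (- 1 / 2 - \<beta>) * (real k powr (\<beta> + \<nu> + 1 / 2) * (C0 * real k powr (- \<nu>)))"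
    using sn \<kappa>_upper[OF k(1)] \<kappa>_pos[OF k(1)] by (intro mult_left_mono mult_mono) auto
  also have "\<dots> = C0 * real k powr ((- 1 / 2 - \<beta>) + (\<beta> + \<nu> + 1 / 2) + (- \<nu>))"
    by (simp only: powr_add mult_ac)
  also have "\<dots> = C0" using k by simp
  finally have "real k powr (- 1 / 2 - \<beta>) \<le> C0 * (1 / (sqrt (real n) * \<kappa> k))"
    using n \<kappa>_pos[OF k(1)] by (simp add: field_simps)
  then have "S * real k powr (- 1 / 2 - \<beta>) \<le> S * (C0 * (1 / (sqrt (real n) * \<kappa> k)))"
    using S by (intro mult_left_mono) auto
  then show ?thesis using \<sigma>_le[OF k(1)] by simp
qed

text \<open>In the detectable case \<open>2 * m\<close> logarithms come from the averaged risk and 2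
  from the squared detection threshold; the prior scale needs 2 to cancel the logarithm in
  \<open>energy\<close>. The exponent \<open>2 * m + 4\<close> covers both.\<close>

lemma signal_le_energy:
  assumes k: "1 \<le> k" and w: "w = 1 + ln (real k)"
  shows "(f0 k)\<^sup>2 * w ^ (2 * m + 2) \<le> real k powr (- (2 * \<beta>)) * w ^ (2 * m + 4) * energy k"
    and "real k powr (- 1 - 2 * \<beta>) \<le> real k powr (- (2 * \<beta>)) * w ^ (2 * m + 4) * energy k"
    and "1 \<le> w"
proof -
  show w1: "1 \<le> w" using k by (simp add: w)
  have "(f0 k)\<^sup>2 * w ^ (2 * m + 2) \<le> (f0 k)\<^sup>2 * w ^ (2 * m + 4)"
    using w1 by (intro mult_left_mono power_increasing) auto
  also have "\<dots> = real k powr (- (2 * \<beta>)) * w ^ (2 * m + 4) * (real k powr (2 * \<beta>) * (f0 k)\<^sup>2)"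
    using k by (simp add: powr_minus field_simps)
  also have "\<dots> \<le> real k powr (- (2 * \<beta>)) * w ^ (2 * m + 4) * energy k"
    using w1 by (intro mult_left_mono) (auto simp: energy_def w)
  finally show "(f0 k)\<^sup>2 * w ^ (2 * m + 2) \<le> real k powr (- (2 * \<beta>)) * w ^ (2 * m + 4) * energy k" .
  have "real k powr (- 1 - 2 * \<beta>) = real k powr (- (2 * \<beta>)) * w ^ 2 * (1 / (real k * w\<^sup>2))"
    using k w1 by (simp add: powr_diff powr_minus field_simps)
  also have "\<dots> \<le> real k powr (- (2 * \<beta>)) * w ^ (2 * m + 4) * energy k"
    using w1 by (intro mult_mono power_increasing) (auto simp: energy_def w)
  finally show "real k powr (- 1 - 2 * \<beta>) \<le> real k powr (- (2 * \<beta>)) * w ^ (2 * m + 4) * energy k" .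
qed

text \<open>The set \<open>A\<close> is the whole line, except for undetectable signals beyond the
  cutoff, where it is the truncation event. All cases are forced into one shape whose dependence on
  \<open>k\<close> is summable.\<close>

lemma coordinate_bound:
  "\<exists>C\<ge>0. \<forall>n\<ge>1. \<forall>k\<ge>1. \<exists>A\<in>sets borel.
    (\<integral>\<^sup>+x. indicator (- A) x \<partial>law n k) \<le> ennreal (C * (cutoff n powr (- 1 / 2) * real k powr (- 3 / 2))) \<and>
    (\<integral>\<^sup>+x. indicator A x * risk n k x \<partial>law n k) \<le>
      ennreal (C * (cutoff n powr (- (2 * \<beta>)) * (1 + ln (cutoff n)) ^ (2 * m + 4) *
        ((if real k \<le> cutoff n then 1 / cutoff n else 0) + energy k)))"
proof -
  obtain C1 where C1: "0 \<le> C1"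
    and risk: "\<And>n k. 1 \<le> n \<Longrightarrow> 1 \<le> k \<Longrightarrow> (\<integral>\<^sup>+x. risk n k x \<partial>law n k) \<le>
      ennreal (C1 * (1 / (sqrt (real n) * \<kappa> k))\<^sup>2 * (1 + ln (real k)) ^ (2 * m))"
    using risk_polylog by blast
  obtain G where G: "0 \<le> G"
    and decay: "\<And>K k. 1 \<le> K \<Longrightarrow> K \<le> k \<Longrightarrow>
      k powr (- (2 * \<beta>)) * (1 + ln k) ^ (2 * m + 4) \<le> G * (K powr (- (2 * \<beta>)) * (1 + ln K) ^ (2 * m + 4))"
    using powr_polylog_decay[of "2 * \<beta>" "2 * m + 4"] \<beta> by auto
  define C2 where "C2 = exp (1 + (S * C0)\<^sup>2 / 2) / h 1 * (LINT x|lborel. x\<^sup>2 * h x)"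
  have C2: "0 \<le> C2"
    unfolding C2_def using less_imp_le[OF h_pos]
    by (intro mult_nonneg_nonneg divide_nonneg_nonneg integral_nonneg_AE) auto
  \<comment> \<open>Beyond the cutoff: \<open>4 * C1\<close> for detectable signals, the rest for
    undetectable ones. In \<open>C\<close> below, the summands serve the low frequencies, the high
    ones after moving the decay from \<open>k\<close> to \<open>K\<close>, and the mass off the
    truncation event.\<close>
  define C3 where "C3 = 4 * C1 + C2 * S\<^sup>2 + 2"
  have C3: "0 \<le> C3" using C1 C2 by (simp add: C3_def)
  define C where "C = C1 / c0\<^sup>2 + C3 * G + 2 * exp (1 / 2)"
  have C: "C1 / c0\<^sup>2 \<le> C" "C3 * G \<le> C" "2 * exp (1 / 2) \<le> C" "0 \<le> C"
    using C1 C3 G by (auto simp: C_def)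
  show ?thesis
  proof (intro exI[of _ C] conjI allI impI)
    show "0 \<le> C" by (rule C)
    fix n k :: nat assume n: "1 \<le> n" and k: "1 \<le> k"
    define K where "K = cutoff n"
    have K: "1 \<le> K" unfolding K_def by (rule cutoff_ge_1[OF n])
    define w where "w = 1 + ln (real k)"
    define \<tau> where "\<tau> = 1 / (sqrt (real n) * \<kappa> k)"
    have \<tau>: "0 < \<tau>" using \<kappa>_pos[OF k] n by (simp add: \<tau>_def)
    note sig = signal_le_energy[OF k w_def]
    have "\<exists>A\<in>sets borel.
      (\<integral>\<^sup>+x. indicator (- A) x \<partial>law n k) \<le> ennreal (C * (K powr (- 1 / 2) * real k powr (- 3 / 2))) \<and>
      (\<integral>\<^sup>+x. indicator A x * risk n k x \<partial>law n k) \<le>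
      ennreal (C * (K powr (- (2 * \<beta>)) * (1 + ln (K)) ^ (2 * m + 4) *
        ((if real k \<le> K then 1 / K else 0) + energy k)))"
    proof (cases "real k \<le> K")
      case True
      have wK: "w ^ (2 * m) \<le> (1 + ln K) ^ (2 * m + 4)"
      proof -
        have "w \<le> 1 + ln K" using True k K by (simp add: w_def)
        then have "w ^ (2 * m) \<le> (1 + ln K) ^ (2 * m)" using sig(3) by (intro power_mono) auto
        also have "\<dots> \<le> (1 + ln K) ^ (2 * m + 4)" using K by (intro power_increasing) auto
        finally show ?thesis .
      qed
      have "C1 * \<tau>\<^sup>2 * w ^ (2 * m) \<le> C1 * (K powr (- (2 * \<beta>)) * (1 / K) / c0\<^sup>2) * (1 + ln K) ^ (2 * m + 4)"
        using low_frequency_le[OF k _ n] True C1 wK sig(3) K unfolding \<tau>_def K_def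
        by (intro mult_mono mult_left_mono) auto
      also have "\<dots> = C1 / c0\<^sup>2 * (K powr (- (2 * \<beta>)) * (1 + ln K) ^ (2 * m + 4) * (1 / K))"
        by (simp add: field_simps)
      also have "\<dots> \<le> C * (K powr (- (2 * \<beta>)) * (1 + ln K) ^ (2 * m + 4) * (1 / K + energy k))"
        using C K energy_nonneg[of k] C1 by (intro mult_mono mult_left_mono) auto
      finally have "C1 * \<tau>\<^sup>2 * w ^ (2 * m) \<le> \<dots>" .
      from order_trans[OF risk[OF n k] ennreal_leI[OF this[unfolded \<tau>_def w_def]]]
      show ?thesis
        using True by (intro bexI[of _ UNIV]) auto
    next
      case False
      then have kK: "K \<le> real k" by simp
      have high: "real k powr (- (2 * \<beta>)) * w ^ (2 * m + 4) * energy k * C3 \<le>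
          C * (K powr (- (2 * \<beta>)) * (1 + ln K) ^ (2 * m + 4) * energy k)"
      proof -
        have "real k powr (- (2 * \<beta>)) * w ^ (2 * m + 4) * (energy k * C3) \<le>
            G * (K powr (- (2 * \<beta>)) * (1 + ln K) ^ (2 * m + 4)) * (energy k * C3)"
          using decay[OF K kK] energy_nonneg[of k] C3 unfolding w_def by (intro mult_right_mono) auto
        also have "\<dots> = C3 * G * (K powr (- (2 * \<beta>)) * (1 + ln K) ^ (2 * m + 4) * energy k)"
          by (simp only: mult_ac)
        also have "\<dots> \<le> C * (K powr (- (2 * \<beta>)) * (1 + ln K) ^ (2 * m + 4) * energy k)"
          using C K energy_nonneg[of k] by (intro mult_right_mono) auto
        finally show ?thesis by (simp only: mult.assoc)
      qed
      define Q where "Q = real k powr (- (2 * \<beta>)) * w ^ (2 * m + 4) * energy k"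
      have Q: "0 \<le> Q" using sig(3) energy_nonneg[of k] by (simp add: Q_def)
      \<comment> \<open>Chosen so that \<open>exp (- T)\<close> is of order
        \<open>k powr (- 2)\<close>; \<open>T \<ge> 1\<close> also keeps the mean of an undetectable
        observation within one standard deviation of 0.\<close>
      define T where "T = 1 + 2 * ln (real k)"
      have T: "1 \<le> T" "T \<le> 2 * w" using k by (auto simp: T_def w_def)
      show ?thesis
      proof (cases "\<bar>f0 k\<bar> * T \<le> \<tau>")
        case True
        let ?A = "{x. \<bar>sqrt (real n) * x\<bar> \<le> T}"
        have A: "?A \<in> sets borel" by measurable
        have sf: "sqrt (real n) * \<kappa> k * \<bar>f0 k\<bar> * T \<le> 1"
          using True \<kappa>_pos[OF k] n by (simp add: \<tau>_def field_simps)
        have "sqrt (real n) * \<kappa> k * \<bar>f0 k\<bar> * 1 \<le> sqrt (real n) * \<kappa> k * \<bar>f0 k\<bar> * T"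
          using T \<kappa>_pos[OF k] by (intro mult_left_mono) auto
        then have "sqrt (real n) * \<kappa> k * \<bar>f0 k\<bar> \<le> 1" using sf by linarith
        then have mean: "\<bar>\<kappa> k * f0 k\<bar> \<le> 1 / sqrt (real n)"
          using \<kappa>_pos[OF k] n by (simp add: abs_mult field_simps)
        have "2 * exp (3 / 2) * exp (- T) = 2 * exp (1 / 2) * real k powr (- 2)"
          using k by (simp add: T_def powr_def flip: exp_add)
        \<comment> \<open>Half a power is traded for \<open>K powr (- 1 / 2)\<close>, which makes
          the total mass vanish as \<open>n\<close> grows; the rest is still summable in
          \<open>k\<close>.\<close>
        also have "\<dots> = 2 * exp (1 / 2) * (real k powr (- 1 / 2) * real k powr (- 3 / 2))"
          by (simp flip: powr_add)
        also have "\<dots> \<le> C * (K powr (- 1 / 2) * real k powr (- 3 / 2))"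
          using C kK K by (intro mult_mono mult_right_mono powr_mono2') auto
        finally have "2 * exp (3 / 2) * exp (- T) \<le> C * (K powr (- 1 / 2) * real k powr (- 3 / 2))" .
        moreover have "(\<integral>\<^sup>+x. indicator (- ?A) x \<partial>law n k) \<le> ennreal (2 * exp (3 / 2) * exp (- T))"
          using normal_tail_le[OF _ mean, of T] n by (simp add: Compl_eq mult.commute)
        ultimately have bad: "(\<integral>\<^sup>+x. indicator (- ?A) x \<partial>law n k) \<le> ennreal (C * (K powr (- 1 / 2) * real k powr (- 3 / 2)))"
          by (meson ennreal_leI order_trans)
        have "C2 * (\<sigma> k)\<^sup>2 \<le> C2 * (S\<^sup>2 * Q)"
        proof -
          have "(\<sigma> k)\<^sup>2 \<le> (S * real k powr (- 1 / 2 - \<beta>))\<^sup>2"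
            using \<sigma>_le[OF k] \<sigma>_pos[OF k] by (intro power_mono) auto
          also have "\<dots> = S\<^sup>2 * real k powr (- 1 - 2 * \<beta>)"
            using k by (simp add: power_mult_distrib powr_power algebra_simps)
          also have "\<dots> \<le> S\<^sup>2 * Q" using sig(2) by (intro mult_left_mono) (auto simp: Q_def)
          finally show ?thesis using C2 by (intro mult_left_mono) auto
        qed
        moreover have "2 * (f0 k)\<^sup>2 \<le> 2 * Q"
        proof -
          have "(f0 k)\<^sup>2 * 1 \<le> (f0 k)\<^sup>2 * w ^ (2 * m + 2)"
            using sig(3) by (intro mult_left_mono one_le_power) auto
          then show ?thesis using sig(1) by (simp add: Q_def)
        qed
        moreover have "0 \<le> 4 * C1 * Q" using C1 Q by simp
        ultimately have "C2 * (\<sigma> k)\<^sup>2 + 2 * (f0 k)\<^sup>2 \<le> Q * C3"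
          by (simp add: C3_def algebra_simps)
        then have le: "C2 * (\<sigma> k)\<^sup>2 + 2 * (f0 k)\<^sup>2 \<le> C * (K powr (- (2 * \<beta>)) * (1 + ln K) ^ (2 * m + 4) * energy k)"
          using high by (simp add: Q_def)
        have n0: "0 < n" and T0: "0 \<le> T" using n T by auto
        have "(\<integral>\<^sup>+x. indicator ?A x * risk n k x \<partial>law n k) \<le> ennreal (C2 * (\<sigma> k)\<^sup>2 + 2 * (f0 k)\<^sup>2)"
          unfolding C2_def
          by (rule truncated_posterior_risk[OF \<sigma>_pos[OF k] \<kappa>_pos[OF k] n0
                high_frequency_scale_le[OF k kK[unfolded K_def] n] sf T0])
        from order_trans[OF this ennreal_leI[OF le]] show ?thesis
          using False bad A by (intro bexI[of _ ?A]) auto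
      next
        case sig_large: False
        \<comment> \<open>For a detectable signal the noise level itself is bounded by the signal,
          so the risk bound without truncation is already of the order of the signal.\<close>
        have "\<tau>\<^sup>2 \<le> (\<bar>f0 k\<bar> * T)\<^sup>2"
          using sig_large \<tau> by (intro power_mono) auto
        also have "\<dots> \<le> (\<bar>f0 k\<bar> * (2 * w))\<^sup>2"
          using T by (intro power_mono mult_left_mono) auto
        also have "\<dots> = 4 * (f0 k)\<^sup>2 * w\<^sup>2"
          by (simp add: power_mult_distrib)
        finally have "C1 * \<tau>\<^sup>2 * w ^ (2 * m) \<le> C1 * (4 * (f0 k)\<^sup>2 * w\<^sup>2) * w ^ (2 * m)"
          using C1 sig(3) by (intro mult_right_mono mult_left_mono) auto
        also have "\<dots> = 4 * C1 * ((f0 k)\<^sup>2 * w ^ (2 * m + 2))"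
          by (simp add: power_add power2_eq_square)
        also have "\<dots> \<le> 4 * C1 * Q"
          using sig(1) C1 by (intro mult_left_mono) (auto simp: Q_def)
        also have "\<dots> \<le> Q * C3"
          using C2 Q by (simp add: C3_def algebra_simps)
        also have "\<dots> \<le> C * (K powr (- (2 * \<beta>)) * (1 + ln K) ^ (2 * m + 4) * energy k)"
          using high by (simp add: Q_def)
        finally have "C1 * \<tau>\<^sup>2 * w ^ (2 * m) \<le> \<dots>" .
        from order_trans[OF risk[OF n k] ennreal_leI[OF this[unfolded \<tau>_def w_def]]]
        show ?thesis
          using False by (intro bexI[of _ UNIV]) auto
      qed
    qed
    then show "\<exists>A\<in>sets borel.
      (\<integral>\<^sup>+x. indicator (- A) x \<partial>law n k) \<le> ennreal (C * (cutoff n powr (- 1 / 2) * real k powr (- 3 / 2))) \<and>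
      (\<integral>\<^sup>+x. indicator A x * risk n k x \<partial>law n k) \<le>
      ennreal (C * (cutoff n powr (- (2 * \<beta>)) * (1 + ln (cutoff n)) ^ (2 * m + 4) *
        ((if real k \<le> cutoff n then 1 / cutoff n else 0) + energy k)))"
      unfolding K_def .
  qed
qed

section \<open>Summation over all frequencies\<close>

lemma sum_low_frequencies:
  assumes K: "1 \<le> K"
  shows "summable (\<lambda>i. if real (Suc i) \<le> K then 1 / K else 0)"
    and "(\<Sum>i. if real (Suc i) \<le> K then 1 / K else 0) \<le> 1"
proof -
  have out: "(if real (Suc i) \<le> K then 1 / K else 0) = 0" if "i \<notin> {..<nat \<lfloor>K\<rfloor>}" for i
    using that K by (auto simp: le_nat_floor) linarith
  show "summable (\<lambda>i. if real (Suc i) \<le> K then 1 / K else 0)"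
    by (rule summable_finite[where N = "{..<nat \<lfloor>K\<rfloor>}"]) (simp, rule out)
  have "(\<Sum>i. if real (Suc i) \<le> K then 1 / K else 0) = (\<Sum>i<nat \<lfloor>K\<rfloor>. if real (Suc i) \<le> K then 1 / K else 0)"
    by (rule suminf_finite) (simp, rule out)
  also have "\<dots> \<le> (\<Sum>i<nat \<lfloor>K\<rfloor>. 1 / K)"
    using K by (intro sum_mono) auto
  also have "\<dots> \<le> 1"
    using K by simp
  finally show "(\<Sum>i. if real (Suc i) \<le> K then 1 / K else 0) \<le> 1" .
qed

lemma summable_energy: "summable (\<lambda>i. energy (Suc i))"
  unfolding energy_def by (intro summable_add f0_summable summable_log_sq)

lemma summable_three_halves: "summable (\<lambda>i. real (Suc i) powr (- 3 / 2))"
  using summable_real_powr_iff[of "- 3 / 2"] by (subst summable_Suc_iff) simp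

text \<open>The witness for \<open>d\<close> is the logarithmic exponent \<open>P\<close> of
  \<open>coordinate_bound\<close>: the squared radius carries the power \<open>2 * P\<close> of
  \<open>ln n\<close>, the risk only \<open>P\<close>, and the quotient \<rho> tends to 0.\<close>

lemma contraction:
  "\<exists>d>0. contracts_at h \<sigma> \<kappa> f0 (\<lambda>n. ln (real n) powr d * real n powr (- (\<beta> / (2 * \<beta> + 2 * \<nu> + 1))))"
proof (intro exI conjI)
  define P where "P = 2 * m + 4"
  show "0 < real P" by (simp add: P_def)
  define \<epsilon> where "\<epsilon> n = ln (real n) powr real P * real n powr (- (\<beta> / (2 * \<beta> + 2 * \<nu> + 1)))" for n :: nat
  obtain C where C: "0 \<le> C"
    and bd: "\<And>n k. 1 \<le> n \<Longrightarrow> 1 \<le> k \<Longrightarrow> \<exists>A\<in>sets borel.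
    (\<integral>\<^sup>+x. indicator (- A) x \<partial>law n k) \<le> ennreal (C * (cutoff n powr (- 1 / 2) * real k powr (- 3 / 2))) \<and>
    (\<integral>\<^sup>+x. indicator A x * risk n k x \<partial>law n k) \<le>
      ennreal (C * (cutoff n powr (- (2 * \<beta>)) * (1 + ln (cutoff n)) ^ P *
        ((if real k \<le> cutoff n then 1 / cutoff n else 0) + energy k)))"
    using coordinate_bound unfolding P_def by blast
  define \<rho> where "\<rho> n = 2 ^ P * ln (real n) powr (- real P)" for n :: nat
  define Z where "Z = (\<Sum>i. real (Suc i) powr (- 3 / 2))"
  define V where "V = (\<Sum>i. energy (Suc i))"
  define post where "post n = (\<integral>\<^sup>+ X. emeasure (posterior h \<sigma> \<kappa> n X)
      {f \<in> space (posterior h \<sigma> \<kappa> n X). ereal (\<epsilon> n) < l2norm (\<lambda>k. f k - f0 k)} \<partial>obs_law \<kappa> f0 n)" for n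
  \<comment> \<open>From \<open>n = 3\<close> on, \<open>ln n \<ge> 1\<close>, so
    \<open>1 + ln K\<close> is at most \<open>2 * ln n\<close> and the radius is positive.\<close>
  have le: "post n \<le> ennreal (C * cutoff n powr (- 1 / 2) * Z + C * \<rho> n * (1 + V))" if n: "3 \<le> n" for n
  proof -
    have n1: "1 \<le> n" "0 < n" using n by auto
    define K where "K = cutoff n"
    have K: "1 \<le> K" unfolding K_def by (rule cutoff_ge_1[OF n1(1)])
    have "1 \<le> ln (real n)"
      using n exp_le ln_ge_iff[of "real n" 1] by auto
    note ln1 = this
    have \<epsilon>_eq: "\<epsilon> n = ln (real n) powr real P * K powr (- \<beta>)"
      using \<beta> \<nu> by (simp add: \<epsilon>_def K_def cutoff_def powr_powr)
    have \<epsilon>: "0 < \<epsilon> n" unfolding \<epsilon>_eq using ln1 K by simp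
    have scale: "1 / (\<epsilon> n)\<^sup>2 * (K powr (- (2 * \<beta>)) * (1 + ln K) ^ P) \<le> \<rho> n"
    proof -
      have "ln K = 1 / (2 * \<beta> + 2 * \<nu> + 1) * ln (real n)"
        using n by (simp add: K_def cutoff_def ln_powr)
      also have "\<dots> \<le> 1 * ln (real n)"
        using ln1 \<beta> \<nu> by (intro mult_right_mono) auto
      finally have "1 + ln K \<le> 2 * ln (real n)" using ln1 by simp
      then have "(1 + ln K) ^ P \<le> (2 * ln (real n)) ^ P"
        using K by (intro power_mono) auto
      also have "\<dots> = 2 ^ P * ln (real n) powr real P"
        using ln1 by (simp add: power_mult_distrib powr_realpow)
      finally have lk: "(1 + ln K) ^ P \<le> 2 ^ P * ln (real n) powr real P" .
      have "(\<epsilon> n)\<^sup>2 = ln (real n) powr real P * ln (real n) powr real P * K powr (- (2 * \<beta>))"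
      proof -
        have "K powr (- \<beta>) * K powr (- \<beta>) = K powr (- (2 * \<beta>))"
          by (simp flip: powr_add)
        then show ?thesis by (simp add: \<epsilon>_eq power2_eq_square mult_ac)
      qed
      then have "1 / (\<epsilon> n)\<^sup>2 * (K powr (- (2 * \<beta>)) * (1 + ln K) ^ P) =
          (1 + ln K) ^ P / (ln (real n) powr real P * ln (real n) powr real P)"
        using K by simp
      also have "\<dots> \<le> 2 ^ P * ln (real n) powr real P / (ln (real n) powr real P * ln (real n) powr real P)"
        using ln1 by (intro divide_right_mono lk) auto
      also have "\<dots> = \<rho> n"
        using ln1 by (simp add: \<rho>_def powr_minus field_simps)
      finally show ?thesis .
    qed
    define good where "good k A \<longleftrightarrow>
      (\<integral>\<^sup>+x. indicator (- A) x \<partial>law n k) \<le> ennreal (C * (K powr (- 1 / 2) * real k powr (- 3 / 2))) \<and>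
      (\<integral>\<^sup>+x. indicator A x * risk n k x \<partial>law n k) \<le>
        ennreal (C * (K powr (- (2 * \<beta>)) * (1 + ln K) ^ P * ((if real k \<le> K then 1 / K else 0) + energy k)))"
      for k A
    \<comment> \<open>The index 0 gets a dummy set, so that one choice function is measurable at
      every index.\<close>
    have "\<exists>A. A \<in> sets borel \<and> (1 \<le> k \<longrightarrow> good k A)" for k
    proof (cases "1 \<le> k")
      case True
      then show ?thesis
        using bd[OF n1(1) True] unfolding good_def K_def by blast
    qed (auto intro: exI[of _ "{}"])
    then obtain A where A: "\<And>k. A k \<in> sets borel" and good: "\<And>k. 1 \<le> k \<Longrightarrow> good k (A k)"
      by metis
    note A1 = good[unfolded good_def, THEN conjunct1] and A2 = good[unfolded good_def, THEN conjunct2]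
    define J where "J i = (if real (Suc i) \<le> K then 1 / K else 0)" for i
    have J0: "0 \<le> J i" for i using K by (simp add: J_def)
    have J: "summable J" "suminf J \<le> 1"
      using sum_low_frequencies[OF K] by (simp_all add: J_def[abs_def])
    define x where "x i = C * K powr (- 1 / 2) * real (Suc i) powr (- 3 / 2) + C * \<rho> n * (J i + energy (Suc i))" for i
    have \<rho>0: "0 \<le> \<rho> n" by (simp add: \<rho>_def)
    have x0: "0 \<le> x i" for i
      using C \<rho>0 J0[of i] energy_nonneg[of "Suc i"] by (simp add: x_def)
    have term_le: "(\<integral>\<^sup>+x. indicator (- A (Suc i)) x \<partial>law n (Suc i)) +
        ennreal (1 / (\<epsilon> n)\<^sup>2) * (\<integral>\<^sup>+x. indicator (A (Suc i)) x * risk n (Suc i) x \<partial>law n (Suc i)) \<le> ennreal (x i)" for i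
    proof -
      have "1 / (\<epsilon> n)\<^sup>2 * (C * (K powr (- (2 * \<beta>)) * (1 + ln K) ^ P * (J i + energy (Suc i)))) =
          (1 / (\<epsilon> n)\<^sup>2 * (K powr (- (2 * \<beta>)) * (1 + ln K) ^ P)) * (C * (J i + energy (Suc i)))"
        by (simp only: mult_ac)
      also have "\<dots> \<le> \<rho> n * (C * (J i + energy (Suc i)))"
        using C J0[of i] energy_nonneg[of "Suc i"] by (intro mult_right_mono scale) auto
      finally have r: "1 / (\<epsilon> n)\<^sup>2 * (C * (K powr (- (2 * \<beta>)) * (1 + ln K) ^ P * (J i + energy (Suc i)))) \<le> C * \<rho> n * (J i + energy (Suc i))"
        by (simp only: mult_ac)
      have "ennreal (1 / (\<epsilon> n)\<^sup>2) * (\<integral>\<^sup>+x. indicator (A (Suc i)) x * risk n (Suc i) x \<partial>law n (Suc i)) \<le>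
          ennreal (1 / (\<epsilon> n)\<^sup>2) * ennreal (C * (K powr (- (2 * \<beta>)) * (1 + ln K) ^ P * (J i + energy (Suc i))))"
        using A2[of "Suc i"] by (intro mult_left_mono) (auto simp: J_def)
      also have "\<dots> = ennreal (1 / (\<epsilon> n)\<^sup>2 * (C * (K powr (- (2 * \<beta>)) * (1 + ln K) ^ P * (J i + energy (Suc i)))))"
        by (rule ennreal_mult'[symmetric]) simp
      also have "\<dots> \<le> ennreal (C * \<rho> n * (J i + energy (Suc i)))"
        by (rule ennreal_leI[OF r])
      finally have "(\<integral>\<^sup>+x. indicator (- A (Suc i)) x \<partial>law n (Suc i)) +
        ennreal (1 / (\<epsilon> n)\<^sup>2) * (\<integral>\<^sup>+x. indicator (A (Suc i)) x * risk n (Suc i) x \<partial>law n (Suc i)) \<le>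
        ennreal (C * (K powr (- 1 / 2) * real (Suc i) powr (- 3 / 2))) + ennreal (C * \<rho> n * (J i + energy (Suc i)))"
        using A1[of "Suc i"] by (intro add_mono) auto
      also have "\<dots> = ennreal (x i)"
        unfolding x_def using C \<rho>0 J0[of i] energy_nonneg[of "Suc i"]
        by (subst ennreal_plus[symmetric]) (auto simp: mult.assoc)
      finally show ?thesis .
    qed
    have "post n \<le> (\<Sum>i. (\<integral>\<^sup>+x. indicator (- A (Suc i)) x \<partial>law n (Suc i)) +
        ennreal (1 / (\<epsilon> n)\<^sup>2) * (\<integral>\<^sup>+x. indicator (A (Suc i)) x * risk n (Suc i) x \<partial>law n (Suc i)))"
      unfolding post_def by (rule expected_posterior_tail_le[OF n1(2) \<sigma>_pos \<kappa>_pos \<epsilon> A])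
    also have "\<dots> \<le> (\<Sum>i. ennreal (x i))"
      by (intro suminf_le term_le summableI)
    also have "\<dots> = ennreal (suminf x)"
    proof (rule suminf_ennreal2[OF x0])
      show "summable x"
        unfolding x_def[abs_def]
        by (intro summable_add summable_mult summable_energy summable_three_halves J(1))
    qed
    also have "suminf x = C * K powr (- 1 / 2) * Z + C * \<rho> n * (suminf J + V)"
      unfolding x_def[abs_def] Z_def V_def
      by (subst suminf_add[symmetric] suminf_mult; (intro summable_add summable_mult summable_energy summable_three_halves J(1))?)+ simp
    also have "ennreal \<dots> \<le> ennreal (C * K powr (- 1 / 2) * Z + C * \<rho> n * (1 + V))"
      using J(2) C \<rho>0 by (intro ennreal_leI add_left_mono mult_left_mono) auto
    finally show ?thesis unfolding K_def .
  qed
  have "(\<lambda>n. C * cutoff n powr (- 1 / 2) * Z + C * \<rho> n * (1 + V)) \<longlonglongrightarrow> C * 0 * Z + C * (2 ^ P * 0) * (1 + V)"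
  proof -
    have "(\<lambda>n. real n powr (1 / (2 * \<beta> + 2 * \<nu> + 1) * (- 1 / 2))) \<longlonglongrightarrow> 0"
      using \<beta> \<nu> by (intro tendsto_neg_powr filterlim_real_sequentially) (auto intro!: mult_pos_neg divide_pos_pos)
    then have c: "(\<lambda>n. cutoff n powr (- 1 / 2)) \<longlonglongrightarrow> 0"
      by (simp only: cutoff_def powr_powr)
    have l: "(\<lambda>n. ln (real n) powr (- real P)) \<longlonglongrightarrow> 0"
      by (intro tendsto_neg_powr filterlim_compose[OF ln_at_top filterlim_real_sequentially]) (simp add: P_def)
    show ?thesis
      unfolding \<rho>_def by (intro tendsto_intros c l)
  qed
  then have lim: "(\<lambda>n. ennreal (C * cutoff n powr (- 1 / 2) * Z + C * \<rho> n * (1 + V))) \<longlonglongrightarrow> 0"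
    using tendsto_ennrealI by fastforce
  have "post \<longlonglongrightarrow> 0"
    by (rule tendsto_sandwich[OF always_eventually[OF allI[OF zero_le]] eventually_sequentiallyI[OF le] tendsto_const lim])
  then show "contracts_at h \<sigma> \<kappa> f0 (\<lambda>n. ln (real n) powr real P * real n powr (- (\<beta> / (2 * \<beta> + 2 * \<nu> + 1))))"
    by (simp add: contracts_at_def post_def[abs_def] \<epsilon>_def)
qed

end

section \<open>The two families of prior scales as instances of the model\<close>

theorem theorem2:
  fixes \<nu> \<beta> L c1 \<kappa>' :: real and \<kappa> f0 :: "nat \<Rightarrow> real" and h :: "real \<Rightarrow> real"
  assumes "\<nu> \<ge> 0"
    and "\<And>k. k \<ge> 1 \<Longrightarrow> \<kappa> k > 0"
    and "asymp_power \<kappa> \<nu>"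
    and "h \<in> borel_measurable borel"
    and "(\<integral>\<^sup>+ x. ennreal (h x) \<partial>lborel) = 1"
    and "\<And>x. h (- x) = h x"
    and "\<And>x. h x > 0"
    and "\<exists>B. \<forall>x. h x \<le> B"
    and "antimono_on {0..} h"
    and "c1 > 0" and "\<kappa>' \<ge> 0"
    and "\<And>x. x \<ge> 0 \<Longrightarrow> ln (1 / h x) \<le> c1 * (1 + ln (1 + x) powr (1 + \<kappa>'))"
    and "integrable lborel (\<lambda>x. x\<^sup>2 * h x)"
    and "\<beta> > 0" and "L > 0"
    and "f0 \<in> sobolev_ball \<beta> L"
  shows "(\<exists>d>0. contracts_at h (\<lambda>k. exp (- (ln (real k))\<^sup>2)) \<kappa> f0
            (\<lambda>n. ln (real n) powr d * real n powr (- (\<beta> / (2 * \<beta> + 2 * \<nu> + 1)))))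
       \<and> (\<forall>\<alpha>>0. \<alpha> \<ge> \<beta> \<longrightarrow>
           (\<exists>d>0. contracts_at h (\<lambda>k. real k powr (- 1 / 2 - \<alpha>)) \<kappa> f0
            (\<lambda>n. ln (real n) powr d * real n powr (- (\<beta> / (2 * \<beta> + 2 * \<nu> + 1))))))"
proof -
  obtain B where B: "\<And>x. h x \<le> B"
    using assms(8) by auto
  obtain c0 C0 where c0: "0 < c0" "c0 \<le> C0"
    and lower: "\<And>k. 1 \<le> k \<Longrightarrow> c0 * real k powr (- \<nu>) \<le> \<kappa> k"
    and upper: "\<And>k. 1 \<le> k \<Longrightarrow> \<kappa> k \<le> C0 * real k powr (- \<nu>)"
    using assms(3) unfolding asymp_power_def by blast
  define m where "m = nat \<lceil>1 + \<kappa>'\<rceil>"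
  have m: "1 + \<kappa>' \<le> real m" by (simp add: m_def) linarith
  have tail: "ln (1 / h x) \<le> 2 * c1 * (1 + ln (1 + x) ^ m)" if x: "0 \<le> x" for x
  proof -
    define y where "y = ln (1 + x)"
    have y: "0 \<le> y" using x by (simp add: y_def)
    \<comment> \<open>Raising the exponent to \<open>m\<close> is monotone only for
      \<open>y \<ge> 1\<close>; the summand 1 covers smaller \<open>y\<close> and leads to the
      doubled constant \<open>2 * c1\<close>.\<close>
    have "y powr (1 + \<kappa>') \<le> 1 + y ^ m"
    proof (cases "y \<le> 1")
      case True
      then have "y powr (1 + \<kappa>') \<le> 1"
        using y assms(11) by (intro powr_le1) auto
      then show ?thesis using y by (simp add: add_increasing2)
    next
      case False
      then have "y powr (1 + \<kappa>') \<le> y powr real m"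
        using m by (intro powr_mono) auto
      then show ?thesis using False by (simp add: powr_realpow)
    qed
    also have "\<dots> \<le> 1 + 2 * y ^ m" using y by simp
    finally have "1 + y powr (1 + \<kappa>') \<le> 2 * (1 + y ^ m)" by simp
    then have "c1 * (1 + y powr (1 + \<kappa>')) \<le> c1 * (2 * (1 + y ^ m))"
      using assms(10) by (intro mult_left_mono) auto
    also have "\<dots> = 2 * c1 * (1 + y ^ m)" by simp
    finally show ?thesis using assms(12)[OF x] by (simp only: y_def)
  qed
  let ?a = "\<lambda>k. real k powr (2 * \<beta>) * (f0 k)\<^sup>2"
  have sm: "?a summable_on {1..}" and le: "(\<Sum>\<^sub>\<infinity>k\<in>{1..}. ?a k) \<le> L\<^sup>2"
    using assms(16) by (auto simp: sobolev_ball_def)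
  note sums = sums_Suc_of_summable_on[OF sm]
  have f0_le: "\<bar>f0 k\<bar> \<le> L" if k1: "1 \<le> k" for k
  proof -
    obtain i where k: "k = Suc i" using k1 by (cases k) auto
    have "(f0 k)\<^sup>2 \<le> ?a k"
      using k1 assms(14) by (simp add: ge_one_powr_ge_zero mult_le_cancel_right1)
    also have "\<dots> = (\<Sum>i\<in>{i}. ?a (Suc i))" by (simp add: k)
    also have "\<dots> \<le> (\<Sum>i. ?a (Suc i))"
      by (rule sum_le_suminf) (use sums sums_summable in auto)
    also have "\<dots> \<le> L\<^sup>2" using sums_unique[OF sums] le by simp
    finally show ?thesis using assms(15) abs_le_square_iff[of "f0 k" L] by simp
  qed
  have contract: "\<exists>d>0. contracts_at h \<sigma> \<kappa> f0
      (\<lambda>n. ln (real n) powr d * real n powr (- (\<beta> / (2 * \<beta> + 2 * \<nu> + 1))))"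
    if \<sigma>: "\<And>k. 1 \<le> k \<Longrightarrow> 0 < \<sigma> k" "\<And>k. 1 \<le> k \<Longrightarrow> \<sigma> k \<le> S * real k powr (- 1 / 2 - \<beta>)"
      "\<And>k. 1 \<le> k \<Longrightarrow> 1 / \<sigma> k \<le> exp (D * (1 + ln (real k))\<^sup>2)"
      and SD: "0 < S" "0 \<le> D" for \<sigma> :: "nat \<Rightarrow> real" and S D
  proof -
    interpret inverse_regression h B "2 * c1" m \<kappa> f0 \<sigma> \<nu> \<beta> c0 C0 L S D
      by unfold_locales
        (use assms(1,4,6,7,9,10,13-15) B tail lower upper c0 f0_le sums_summable[OF sums] \<sigma> SD in auto)
    show ?thesis by (rule contraction)
  qed
  have "\<exists>d>0. contracts_at h (\<lambda>k. exp (- (ln (real k))\<^sup>2)) \<kappa> f0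
      (\<lambda>n. ln (real n) powr d * real n powr (- (\<beta> / (2 * \<beta> + 2 * \<nu> + 1))))"
  \<comment> \<open>With \<open>a = 1 / 2 + \<beta>\<close> and \<open>l = ln k\<close>, completing
    the square gives \<open>- l\<^sup>2 \<le> a\<^sup>2 - a * l\<close>, hence this
    \<open>S\<close>; and \<open>l\<^sup>2 \<le> (1 + l)\<^sup>2\<close> gives
    \<open>D\<close>.\<close>
  proof (rule contract[where S = "exp ((1 / 2 + \<beta>)\<^sup>2)" and D = 1])
    fix k :: nat assume k: "1 \<le> k"
    define l where "l = ln (real k)"
    define a where "a = 1 / 2 + \<beta>"
    have l: "0 \<le> l" using k by (simp add: l_def)
    have "0 \<le> (l - a / 2)\<^sup>2 + 3 / 4 * a\<^sup>2" by simp
    also have "\<dots> = a\<^sup>2 + (- a) * l + l\<^sup>2" by (simp add: power2_eq_square algebra_simps)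
    finally have "- l\<^sup>2 \<le> a\<^sup>2 + (- a) * l" by linarith
    then have "exp (- l\<^sup>2) \<le> exp (a\<^sup>2) * exp ((- a) * l)" by (simp flip: exp_add)
    moreover have "- 1 / 2 - \<beta> = - a" by (simp add: a_def)
    then have "real k powr (- 1 / 2 - \<beta>) = exp ((- a) * l)"
      using k by (simp add: powr_def l_def)
    ultimately show "exp (- (ln (real k))\<^sup>2) \<le> exp ((1 / 2 + \<beta>)\<^sup>2) * real k powr (- 1 / 2 - \<beta>)"
      by (simp only: a_def l_def)
    have "l\<^sup>2 \<le> (1 + l)\<^sup>2" using l by (intro power_mono) auto
    then show "1 / exp (- (ln (real k))\<^sup>2) \<le> exp (1 * (1 + ln (real k))\<^sup>2)"
      by (simp add: l_def exp_minus divide_inverse)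
  qed auto
  moreover have "\<exists>d>0. contracts_at h (\<lambda>k. real k powr (- 1 / 2 - \<alpha>)) \<kappa> f0
      (\<lambda>n. ln (real n) powr d * real n powr (- (\<beta> / (2 * \<beta> + 2 * \<nu> + 1))))"
    if \<alpha>: "0 < \<alpha>" "\<beta> \<le> \<alpha>" for \<alpha>
  \<comment> \<open>The bound with \<open>S = 1\<close> is where \<alpha> \<ge> \<beta> enters. The
    inverse scale is a power of \<open>k\<close>, and \<open>ln k \<le> (1 + ln k)\<^sup>2\<close>
    brings it into the required form.\<close>
  proof (rule contract[where S = 1 and D = "1 / 2 + \<alpha>"])
    fix k :: nat assume k: "1 \<le> k"
    show "real k powr (- 1 / 2 - \<alpha>) \<le> 1 * real k powr (- 1 / 2 - \<beta>)"
      using k \<alpha> by (simp add: powr_mono)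
    define l where "l = ln (real k)"
    have l: "0 \<le> l" using k by (simp add: l_def)
    then have "l \<le> (1 + l)\<^sup>2" by (simp add: power2_eq_square algebra_simps)
    then have "(1 / 2 + \<alpha>) * l \<le> (1 / 2 + \<alpha>) * (1 + l)\<^sup>2"
      using \<alpha> by (intro mult_left_mono) auto
    moreover have "1 / real k powr (- 1 / 2 - \<alpha>) = real k powr - (- 1 / 2 - \<alpha>)"
      by (simp only: powr_minus_divide)
    then have "1 / real k powr (- 1 / 2 - \<alpha>) = exp ((1 / 2 + \<alpha>) * l)"
      using k by (simp add: powr_def l_def)
    ultimately show "1 / real k powr (- 1 / 2 - \<alpha>) \<le> exp ((1 / 2 + \<alpha>) * (1 + ln (real k))\<^sup>2)"
      by (simp add: l_def)
  qed (use \<alpha> in auto)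
  ultimately show ?thesis by blast
qed

end
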